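(* Let $(\mathrm X,\mathsf d,\mathfrak m)$ be a metric measure space. Every normed $L^0(\mathfrak m)$-module can be written as (i.e. is isomorphic, in the category of normed $L^0(\mathfrak m)$-modules, to) the direct limit of some direct system of finitely-generated normed $L^0(\mathfrak m)$-modules.
   Context: A metric measure space $(\mathrm X,\mathsf d,\mathfrak m)$ is a complete separable metric space $(\mathrm X,\mathsf d)$ with a Radon measure $\mathfrak m\geq 0$. $L^0(\mathfrak m)$ is the commutative ring of Borel functions $f\colon\mathrm X\to\mathbb R$ up to $\mathfrak m$-a.e. equality, with distance $\mathsf d_{L^0(\mathfrak m)}(f,g)=\int|f-g|\wedge 1\,\mathrm d\mathfrak m'$, where $\mathfrak m'$ is any Borel probability measure with $\mathfrak m\ll\mathfrak m'\ll\mathfrak m$. A pointwise norm on an $L^0(\mathfrak m)$-module $\mathscr M$ is a map $|\cdot|\colon\mathscr M\to L^0(\mathfrak m)$ such that, $\mathfrak m$-a.e., $|v|\geq 0$, $|v+w|\leq|v|+|w|$, $|f\cdot v|=|f||v|$ for all $v,w\in\mathscr M$, $f\in L^0(\mathfrak m)$, and $|v|=0$ $\mathfrak m$-a.e. if and only if $v=0$. A normed $L^0(\mathfrak m)$-module is an $L^0(\mathfrak m)$-module $\mathscr M$ with a pointwise norm such that the distance $\mathsf d_{\mathscr M}(v,w)=\int|v-w|\wedge 1\,\mathrm d\mathfrak m'$ is complete. A morphism $\varphi\colon\mathscr M\to\mathscr N$ of normed $L^0(\mathfrak m)$-modules is an $L^0(\mathfrak m)$-linear map with $|\varphi(v)|\leq|v|$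 $\mathfrak m$-a.e. for every $v\in\mathscr M$. This defines the category of normed $L^0(\mathfrak m)$-modules. A subset $S\subseteq\mathscr M$ generates $\mathscr M$ if the set of finite sums $\sum_{i=1}^n f_i\cdot v_i$ ($f_i\in L^0(\mathfrak m)$, $v_i\in S$) is $\mathsf d_{\mathscr M}$-dense in $\mathscr M$; $\mathscr M$ is finitely-generated if it is generated by a finite subset. A directed partially ordered set is a nonempty partially ordered set in which any two elements have an upper bound. A direct system over a directed partially ordered set $(I,\leq)$ consists of objects $\{\mathscr M_i\}_{i\in I}$ and morphisms $\varphi_{ij}\colon\mathscr M_i\to\mathscr M_j$ for $i\leq j$ with $\varphi_{ii}=\mathrm{id}$ and $\varphi_{ik}=\varphi_{jk}\circ\varphi_{ij}$ for $i\leq j\leq k$. A target of it is a couple $(\mathscr N,\{\psi_i\}_{i\in I})$ of an object $\mathscr N$ and morphisms $\psi_i\colon\mathscr M_i\to\mathscr N$ with $\psi_j\circ\varphi_{ij}=\psi_i$ for all $i\leq j$. The direct limit $\big(\varinjlim\mathscr M_\star,\{\varphi_i\}_{i\in I}\big)$ is a target such that for every target $(\mathscr N,\{\psi_i\}_{i\in I})$ there is a unique morphism $\Phi\colon\varinjlim\mathscr M_\star\to\mathscr N$ with $\Phi\circ\varphi_i=\psi_i$ for every $i\in I$. *)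

theory Defs
  imports "HOL-Probability.Probability_Measure" "HOL-Algebra.Module"
begin

section \<open>Metric measure spaces\<close>

text \<open>The complete separable metric space is a type of class \<open>polish_space\<close>
  (complete metric and second countable).
  The measure is a locally finite, inner regular Borel measure. In a metric space, local finiteness
  of an inner regular measure is the same as finiteness on compact sets.\<close>

definition radon_measure :: "'x::polish_space measure \<Rightarrow> bool" where
  "radon_measure m \<longleftrightarrow>
     sets m = sets borel \<and>
     (\<forall>x. \<exists>U. open U \<and> x \<in> U \<and> emeasure m U < \<infinity>) \<and>
     (\<forall>B\<in>sets borel. emeasure m B = (SUP K\<in>{K. compact K \<and> K \<subseteq> B}. emeasure m K))"

text \<open>The auxiliary measure \<open>m'\<close> used to define distances: a Borel probability measure with
  \<open>m \<lless> m' \<lless> m\<close>. No such probability measure exists if \<open>m = 0\<close>;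
  in that degenerate case \<open>m' = 0\<close> is used.\<close>

definition reference_measure :: "'x::polish_space measure \<Rightarrow> 'x measure \<Rightarrow> bool" where
  "reference_measure m m' \<longleftrightarrow>
     sets m' = sets borel \<and> absolutely_continuous m m' \<and> absolutely_continuous m' m \<and>
     (prob_space m' \<or> m = null_measure borel)"


section \<open>The ring of measurable functions modulo almost everywhere equality\<close>

definition ae_class :: "'x measure \<Rightarrow> ('x \<Rightarrow> real) \<Rightarrow> ('x \<Rightarrow> real) set" where
  "ae_class m f = {g \<in> borel_measurable m. AE x in m. g x = f x}"

definition L0 :: "'x measure \<Rightarrow> ('x \<Rightarrow> real) set ring" where
  "L0 m =
     \<lparr>carrier = ae_class m ` borel_measurable m,
      mult = (\<lambda>F G. \<Union>f\<in>F. \<Union>g\<in>G. ae_class m (\<lambda>x. f x * g x)),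
      one = ae_class m (\<lambda>x. 1),
      zero = ae_class m (\<lambda>x. 0),
      add = (\<lambda>F G. \<Union>f\<in>F. \<Union>g\<in>G. ae_class m (\<lambda>x. f x + g x))\<rparr>"

definition L0_abs :: "'x measure \<Rightarrow> ('x \<Rightarrow> real) set \<Rightarrow> ('x \<Rightarrow> real) set" where
  "L0_abs m F = (\<Union>f\<in>F. ae_class m (\<lambda>x. \<bar>f x\<bar>))"

definition L0_le :: "'x measure \<Rightarrow> ('x \<Rightarrow> real) set \<Rightarrow> ('x \<Rightarrow> real) set \<Rightarrow> bool" where
  "L0_le m F G \<longleftrightarrow> (\<exists>f\<in>F. \<exists>g\<in>G. AE x in m. f x \<le> g x)"

text \<open>\<open>\<integral> F \<and> 1 dm'\<close>; the value does not depend on the representative when \<open>m' \<lless> m\<close>.\<close>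

definition L0_trunc_integral :: "'x measure \<Rightarrow> ('x \<Rightarrow> real) set \<Rightarrow> real" where
  "L0_trunc_integral m' F = (LINT x|m'. min ((SOME f. f \<in> F) x) 1)"


section \<open>Normed modules\<close>

record ('x, 'v) nmodule = "(('x \<Rightarrow> real) set, 'v) module" +
  pnorm :: "'v \<Rightarrow> ('x \<Rightarrow> real) set"

text \<open>The distance is set to 0 off the carrier because the library's \<open>Metric_space\<close> demands
  nonnegativity and symmetry on the whole type.\<close>

definition mod_dist :: "'x measure \<Rightarrow> ('x, 'v) nmodule \<Rightarrow> 'v \<Rightarrow> 'v \<Rightarrow> real" where
  "mod_dist m' M v w =
     (if v \<in> carrier M \<and> w \<in> carrier M
      then L0_trunc_integral m' (pnorm M (v \<ominus>\<^bsub>M\<^esub> w)) else 0)"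

locale pointwise_normed_module = module "L0 m" M
  for m :: "'x::polish_space measure" and M :: "('x, 'v) nmodule" (structure) +
  assumes pnorm_closed: "v \<in> carrier M \<Longrightarrow> pnorm M v \<in> carrier (L0 m)"
    and pnorm_nonneg: "v \<in> carrier M \<Longrightarrow> L0_le m \<zero>\<^bsub>L0 m\<^esub> (pnorm M v)"
    and pnorm_triangle: "\<lbrakk>v \<in> carrier M; w \<in> carrier M\<rbrakk> \<Longrightarrow>
          L0_le m (pnorm M (v \<oplus>\<^bsub>M\<^esub> w)) (pnorm M v \<oplus>\<^bsub>L0 m\<^esub> pnorm M w)"
    and pnorm_smult: "\<lbrakk>F \<in> carrier (L0 m); v \<in> carrier M\<rbrakk> \<Longrightarrow>
          pnorm M (F \<odot>\<^bsub>M\<^esub> v) = L0_abs m F \<otimes>\<^bsub>L0 m\<^esub> pnorm M v"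
    and pnorm_eq_zero: "v \<in> carrier M \<Longrightarrow> pnorm M v = \<zero>\<^bsub>L0 m\<^esub> \<longleftrightarrow> v = \<zero>\<^bsub>M\<^esub>"

locale normed_L0_module = pointwise_normed_module m M
  for m m' :: "'x::polish_space measure" and M :: "('x, 'v) nmodule" (structure) +
  assumes complete: "Metric_space.mcomplete (carrier M) (mod_dist m' M)"

definition L0_combinations :: "'x measure \<Rightarrow> ('x, 'v) nmodule \<Rightarrow> 'v set \<Rightarrow> 'v set" where
  "L0_combinations m M S =
     {\<Oplus>\<^bsub>M\<^esub>k\<in>{1..n}. F k \<odot>\<^bsub>M\<^esub> v k | (n::nat) F v.
        F \<in> {1..n} \<rightarrow> carrier (L0 m) \<and> v \<in> {1..n} \<rightarrow> S}"

definition generates ::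
    "'x measure \<Rightarrow> 'x measure \<Rightarrow> ('x, 'v) nmodule \<Rightarrow> 'v set \<Rightarrow> bool" where
  "generates m m' M S \<longleftrightarrow>
     S \<subseteq> carrier M \<and>
     Metric_space.mtopology (carrier M) (mod_dist m' M) closure_of L0_combinations m M S
       = carrier M"

definition finitely_generated ::
    "'x measure \<Rightarrow> 'x measure \<Rightarrow> ('x, 'v) nmodule \<Rightarrow> bool" where
  "finitely_generated m m' M \<longleftrightarrow> (\<exists>S. finite S \<and> generates m m' M S)"


section \<open>The category of normed modules\<close>

text \<open>Morphisms are extensional functions on the carrier, so that equality of morphisms is HOL
  equality; composition is \<open>compose\<close> and the identity is \<open>restrict\<close>ed.\<close>

definition normed_morphisms ::
    "'x measure \<Rightarrow> ('x, 'v) nmodule \<Rightarrow> ('x, 'w) nmodule \<Rightarrow> ('v \<Rightarrow> 'w) set" where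
  "normed_morphisms m M N =
     {\<phi> \<in> carrier M \<rightarrow>\<^sub>E carrier N.
        (\<forall>v\<in>carrier M. \<forall>w\<in>carrier M. \<phi> (v \<oplus>\<^bsub>M\<^esub> w) = \<phi> v \<oplus>\<^bsub>N\<^esub> \<phi> w) \<and>
        (\<forall>F\<in>carrier (L0 m). \<forall>v\<in>carrier M. \<phi> (F \<odot>\<^bsub>M\<^esub> v) = F \<odot>\<^bsub>N\<^esub> \<phi> v) \<and>
        (\<forall>v\<in>carrier M. L0_le m (pnorm N (\<phi> v)) (pnorm M v))}"

definition isomorphic ::
    "'x measure \<Rightarrow> ('x, 'v) nmodule \<Rightarrow> ('x, 'w) nmodule \<Rightarrow> bool" where
  "isomorphic m M N \<longleftrightarrow>
     (\<exists>\<phi>\<in>normed_morphisms m M N. \<exists>\<psi>\<in>normed_morphisms m N M.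
        compose (carrier M) \<psi> \<phi> = (\<lambda>v\<in>carrier M. v) \<and>
        compose (carrier N) \<phi> \<psi> = (\<lambda>w\<in>carrier N. w))"

definition directed_poset :: "'i set \<Rightarrow> ('i \<times> 'i) set \<Rightarrow> bool" where
  "directed_poset I r \<longleftrightarrow>
     I \<noteq> {} \<and> partial_order_on I r \<and> (\<forall>i\<in>I. \<forall>j\<in>I. \<exists>k\<in>I. (i, k) \<in> r \<and> (j, k) \<in> r)"

definition direct_system ::
    "'x::polish_space measure \<Rightarrow> 'x measure \<Rightarrow> 'i set \<Rightarrow> ('i \<times> 'i) set \<Rightarrow>
     ('i \<Rightarrow> ('x, 'v) nmodule) \<Rightarrow> ('i \<Rightarrow> 'i \<Rightarrow> 'v \<Rightarrow> 'v) \<Rightarrow> bool" where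
  "direct_system m m' I r D \<phi> \<longleftrightarrow>
     directed_poset I r \<and>
     (\<forall>i\<in>I. normed_L0_module m m' (D i)) \<and>
     (\<forall>(i, j)\<in>r. \<phi> i j \<in> normed_morphisms m (D i) (D j)) \<and>
     (\<forall>i\<in>I. \<phi> i i = (\<lambda>v\<in>carrier (D i). v)) \<and>
     (\<forall>i j k. (i, j) \<in> r \<longrightarrow> (j, k) \<in> r \<longrightarrow>
        \<phi> i k = compose (carrier (D i)) (\<phi> j k) (\<phi> i j))"

definition is_target ::
    "'x::polish_space measure \<Rightarrow> 'x measure \<Rightarrow> 'i set \<Rightarrow> ('i \<times> 'i) set \<Rightarrow>
     ('i \<Rightarrow> ('x, 'v) nmodule) \<Rightarrow> ('i \<Rightarrow> 'i \<Rightarrow> 'v \<Rightarrow> 'v) \<Rightarrow>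
     ('x, 'w) nmodule \<Rightarrow> ('i \<Rightarrow> 'v \<Rightarrow> 'w) \<Rightarrow> bool" where
  "is_target m m' I r D \<phi> N \<psi> \<longleftrightarrow>
     normed_L0_module m m' N \<and>
     (\<forall>i\<in>I. \<psi> i \<in> normed_morphisms m (D i) N) \<and>
     (\<forall>(i, j)\<in>r. compose (carrier (D i)) (\<psi> j) (\<phi> i j) = \<psi> i)"

text \<open>HOL cannot quantify over types inside a formula, so the type \<open>'w\<close> of the elements of the
  test objects is a parameter. Lemma \<open>is_direct_limit_any_type\<close> below shows that if the universal
  property holds for a single, explicit type, then it holds for all types.\<close>

definition is_direct_limit ::
    "'w itself \<Rightarrow> 'x::polish_space measure \<Rightarrow> 'x measure \<Rightarrow> 'i set \<Rightarrow> ('i \<times> 'i) set \<Rightarrow>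
     ('i \<Rightarrow> ('x, 'v) nmodule) \<Rightarrow> ('i \<Rightarrow> 'i \<Rightarrow> 'v \<Rightarrow> 'v) \<Rightarrow>
     ('x, 'l) nmodule \<Rightarrow> ('i \<Rightarrow> 'v \<Rightarrow> 'l) \<Rightarrow> bool" where
  "is_direct_limit (_ :: 'w itself) m m' I r D \<phi> L \<iota> \<longleftrightarrow>
     is_target m m' I r D \<phi> L \<iota> \<and>
     (\<forall>(N :: ('x, 'w) nmodule) \<psi>. is_target m m' I r D \<phi> N \<psi> \<longrightarrow>
        (\<exists>!\<Phi>. \<Phi> \<in> normed_morphisms m L N \<and>
          (\<forall>i\<in>I. compose (carrier (D i)) \<Phi> (\<iota> i) = \<psi> i)))"


section \<open>Consistency of the definitions\<close>

lemma ae_class_eq_iff: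
  assumes "f \<in> borel_measurable m" "g \<in> borel_measurable m"
  shows "ae_class m f = ae_class m g \<longleftrightarrow> (AE x in m. f x = g x)"
proof
  assume "ae_class m f = ae_class m g"
  moreover have "f \<in> ae_class m f" using assms by (simp add: ae_class_def)
  ultimately show "AE x in m. f x = g x" by (simp add: ae_class_def)
next
  assume *: "AE x in m. f x = g x"
  have "(AE x in m. h x = f x) \<longleftrightarrow> (AE x in m. h x = g x)" for h
    using * by (auto elim: eventually_elim2)
  then show "ae_class m f = ae_class m g" by (simp add: ae_class_def)
qed

lemma ae_class_self: "f \<in> borel_measurable m \<Longrightarrow> f \<in> ae_class m f"
  by (simp add: ae_class_def)

lemma ae_classD: "g \<in> ae_class m f \<Longrightarrow> g \<in> borel_measurable m \<and> (AE x in m. g x = f x)"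
  by (simp add: ae_class_def)

lemma ae_class_lift2:
  assumes f: "f \<in> borel_measurable m" and g: "g \<in> borel_measurable m"
    and op: "\<And>f g. f \<in> borel_measurable m \<Longrightarrow> g \<in> borel_measurable m \<Longrightarrow>
                (\<lambda>x. op (f x) (g x)) \<in> borel_measurable m"
  shows "(\<Union>f'\<in>ae_class m f. \<Union>g'\<in>ae_class m g. ae_class m (\<lambda>x. op (f' x) (g' x)))
           = ae_class m (\<lambda>x. op (f x) (g x))"
proof -
  have "ae_class m (\<lambda>x. op (f' x) (g' x)) = ae_class m (\<lambda>x. op (f x) (g x))"
    if "f' \<in> ae_class m f" "g' \<in> ae_class m g" for f' g'
  proof -
    from that have *: "f' \<in> borel_measurable m" "g' \<in> borel_measurable m"
      "AE x in m. f' x = f x" "AE x in m. g' x = g x" by (auto dest: ae_classD)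
    have "AE x in m. op (f' x) (g' x) = op (f x) (g x)"
      using *(3,4) by eventually_elim simp
    then show ?thesis by (subst ae_class_eq_iff) (auto intro: op * f g)
  qed
  then show ?thesis using ae_class_self[OF f] ae_class_self[OF g] by blast
qed

lemma L0_simps:
  shows "carrier (L0 m) = ae_class m ` borel_measurable m"
    and "\<one>\<^bsub>L0 m\<^esub> = ae_class m (\<lambda>x. 1)"
    and "\<zero>\<^bsub>L0 m\<^esub> = ae_class m (\<lambda>x. 0)"
    and "\<lbrakk>f \<in> borel_measurable m; g \<in> borel_measurable m\<rbrakk> \<Longrightarrow>
           ae_class m f \<otimes>\<^bsub>L0 m\<^esub> ae_class m g = ae_class m (\<lambda>x. f x * g x)"
    and "\<lbrakk>f \<in> borel_measurable m; g \<in> borel_measurable m\<rbrakk> \<Longrightarrow>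
           ae_class m f \<oplus>\<^bsub>L0 m\<^esub> ae_class m g = ae_class m (\<lambda>x. f x + g x)"
  by (simp_all add: L0_def ae_class_lift2)

lemma L0_abs_ae_class:
  "f \<in> borel_measurable m \<Longrightarrow> L0_abs m (ae_class m f) = ae_class m (\<lambda>x. \<bar>f x\<bar>)"
  unfolding L0_abs_def using ae_class_lift2[of f m f "\<lambda>x y. \<bar>x\<bar>"] ae_class_self[of f m]
  by (simp split: if_splits)

lemma L0_le_ae_class:
  assumes "f \<in> borel_measurable m" "g \<in> borel_measurable m"
  shows "L0_le m (ae_class m f) (ae_class m g) \<longleftrightarrow> (AE x in m. f x \<le> g x)"
proof
  assume "L0_le m (ae_class m f) (ae_class m g)"
  then obtain f' g' where "f' \<in> ae_class m f" "g' \<in> ae_class m g" "AE x in m. f' x \<le> g' x"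
    by (auto simp: L0_le_def)
  then have "AE x in m. f' x = f x" "AE x in m. g' x = g x" "AE x in m. f' x \<le> g' x"
    by (auto dest: ae_classD)
  then show "AE x in m. f x \<le> g x" by eventually_elim simp
next
  assume "AE x in m. f x \<le> g x"
  then show "L0_le m (ae_class m f) (ae_class m g)"
    using ae_class_self assms by (auto simp: L0_le_def)
qed

lemma L0_cases:
  assumes "F \<in> carrier (L0 m)"
  obtains f where "f \<in> borel_measurable m" "F = ae_class m f"
  using assms by (auto simp: L0_simps)

lemma L0_closed: "f \<in> borel_measurable m \<Longrightarrow> ae_class m f \<in> carrier (L0 m)"
  by (simp add: L0_simps)

lemma cring_L0: "cring (L0 m)"
proof (rule cringI)
  show "abelian_group (L0 m)"
  proof (rule abelian_groupI)
    fix F assume "F \<in> carrier (L0 m)"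
    then obtain f where f[measurable]: "f \<in> borel_measurable m" "F = ae_class m f"
      by (rule L0_cases)
    have "ae_class m (\<lambda>x. - f x) \<oplus>\<^bsub>L0 m\<^esub> F = \<zero>\<^bsub>L0 m\<^esub>"
      using f by (simp add: L0_simps)
    then show "\<exists>G\<in>carrier (L0 m). G \<oplus>\<^bsub>L0 m\<^esub> F = \<zero>\<^bsub>L0 m\<^esub>"
      using f by (intro bexI[of _ "ae_class m (\<lambda>x. - f x)"]) (auto intro: L0_closed)
  qed (auto elim!: L0_cases simp: L0_simps(2-5) add_ac intro!: L0_closed)
  show "comm_monoid (L0 m)"
    by (rule comm_monoidI)
       (auto elim!: L0_cases simp: L0_simps(2-5) mult_ac intro!: L0_closed)
qed (auto elim!: L0_cases simp: L0_simps(2-5) algebra_simps intro!: L0_closed)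

lemma radon_measure_imp_ex_reference_measure:
  assumes "radon_measure m"
  shows "\<exists>m'. reference_measure m m'"
proof (cases "m = null_measure borel")
  case True
  then show ?thesis
    by (intro exI[of _ m]) (auto simp: reference_measure_def absolutely_continuous_def)
next
  case False
  have sb: "sets m = sets borel" and sp: "space m = UNIV"
    using assms sets_eq_imp_space_eq[of m borel] by (auto simp: radon_measure_def)
  obtain U where U: "\<And>x. open (U x)" "\<And>x. x \<in> U x" "\<And>x. emeasure m (U x) < \<infinity>"
    using assms unfolding radon_measure_def by metis
  obtain \<U> where \<U>: "\<U> \<subseteq> range U" "countable \<U>" "\<Union>\<U> = \<Union>(range U)"
    using Lindelof[of "range U"] U(1) by (metis imageE)
  interpret sigma_finite_measure m
  proof
    show "\<exists>A. countable A \<and> A \<subseteq> sets m \<and> \<Union>A = space m \<and> (\<forall>a\<in>A. emeasure m a \<noteq> \<infinity>)"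
    proof (intro exI[of _ \<U>] conjI ballI)
      show "\<U> \<subseteq> sets m" using \<U>(1) U(1) sb by auto
      show "\<Union>\<U> = space m" using \<U>(3) U(2) sp by auto
      show "emeasure m a \<noteq> \<infinity>" if "a \<in> \<U>" for a
        using \<U>(1) U(3) that by (metis imageE subsetD infinity_ennreal_def less_irrefl)
    qed (rule \<U>(2))
  qed
  obtain h :: "'a \<Rightarrow> real" where h[measurable]: "h \<in> borel_measurable m"
    and pos: "\<And>x. h x > 0" and int: "integrable m h"
    using obtain_positive_integrable_function by metis
  have "\<not> (AE x in m. False)"
  proof
    assume "AE x in m. False"
    then have "emeasure m (space m) = 0" using AE_iff_measurable[of "space m" m "\<lambda>x. False"] by simp
    then have "emeasure m A = 0" for A
      using emeasure_space[of m A] by simp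
    then have "m = null_measure borel"
      by (intro measure_eqI) (simp_all add: sb)
    with False show False by simp
  qed
  then have ne: "integral\<^sup>L m h \<noteq> 0"
    using integral_nonneg_eq_0_iff_AE[OF int] pos
    by (auto simp: less_imp_le less_imp_neq[OF pos, symmetric])
  with pos have c: "integral\<^sup>L m h > 0"
    by (metis integral_nonneg_AE AE_I2 less_imp_le order_less_le)
  define k where "k = (\<lambda>x. ennreal (h x / integral\<^sup>L m h))"
  have [measurable]: "k \<in> borel_measurable m" by (simp add: k_def)
  have "(\<integral>\<^sup>+x. k x \<partial>m) = 1"
    unfolding k_def using c pos int
    by (subst nn_integral_eq_integral) (auto simp: less_imp_le)
  then have "prob_space (density m k)"
    by (intro prob_spaceI) (simp add: emeasure_density cong: nn_integral_cong_simp)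
  moreover have "k x \<noteq> 0" for x using c pos[of x] by (simp add: k_def not_le)
  then have "absolutely_continuous (density m k) m"
    unfolding absolutely_continuous_def by (auto simp: null_sets_density_iff AE_iff_null_sets)
  ultimately show ?thesis
    using absolutely_continuousI_density[of k m] sb
    by (intro exI[of _ "density m k"]) (simp add: reference_measure_def)
qed

lemma reference_measure_AE_iff:
  assumes "sets m = sets borel" "reference_measure m m'"
  shows "(AE x in m'. P x) \<longleftrightarrow> (AE x in m. P x)"
proof -
  have "null_sets m = null_sets m'" "space m = space m'"
    using assms sets_eq_imp_space_eq[of m m']
    by (auto simp: reference_measure_def absolutely_continuous_def)
  then show ?thesis by (simp add: eventually_ae_filter)
qed

lemma reference_measure_finite:
  assumes "reference_measure m m'"
  shows "finite_measure m'"
proof (cases "prob_space m'")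
  case True then show ?thesis by (simp add: prob_space_def)
next
  case False
  with assms have m: "m = null_measure borel" and s: "sets m' = sets borel"
    and ac: "absolutely_continuous m m'"
    by (auto simp: reference_measure_def)
  then have "space m' \<in> null_sets m"
    using sets.top[of m'] by (auto simp: null_sets_def)
  then have "emeasure m' (space m') = 0"
    using ac by (auto simp: absolutely_continuous_def null_sets_def)
  then show ?thesis by (intro finite_measureI) simp
qed

lemma L0_trunc_integral_ae_class:
  assumes sb: "sets m = sets borel" and ref: "reference_measure m m'"
    and f: "f \<in> borel_measurable m"
  shows "L0_trunc_integral m' (ae_class m f) = (LINT x|m'. min (f x) 1)"
proof -
  let ?g = "SOME g. g \<in> ae_class m f"
  have g: "?g \<in> ae_class m f"
    by (rule someI[where P="\<lambda>g. g \<in> ae_class m f", OF ae_class_self[OF f]])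
  have s: "sets m' = sets m" using sb ref by (simp add: reference_measure_def)
  have [measurable]: "f \<in> borel_measurable m'" "?g \<in> borel_measurable m'"
    using f ae_classD[OF g] by (simp_all cong: measurable_cong_sets[OF s refl])
  have "AE x in m'. ?g x = f x"
    using ae_classD[OF g] by (simp add: reference_measure_AE_iff[OF sb ref])
  then show ?thesis unfolding L0_trunc_integral_def
    by (intro integral_cong_AE) (auto elim: eventually_mono)
qed

lemma trunc_integrable:
  fixes f :: "'x::polish_space \<Rightarrow> real"
  assumes sb: "sets m = sets borel" and ref: "reference_measure m m'"
    and f: "f \<in> borel_measurable m" "AE x in m. 0 \<le> f x"
  shows "integrable m' (\<lambda>x. min (f x) 1)"
proof -
  interpret finite_measure m' by (rule reference_measure_finite[OF ref])
  have s: "sets m' = sets m" using sb ref by (simp add: reference_measure_def)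
  have [measurable]: "f \<in> borel_measurable m'"
    using f by (simp cong: measurable_cong_sets[OF s refl])
  have "AE x in m'. 0 \<le> f x" using f by (simp add: reference_measure_AE_iff[OF sb ref])
  then show ?thesis
    by (intro integrable_const_bound[of _ 1]) (auto elim: eventually_mono)
qed

lemma (in pointwise_normed_module) pnorm_cases:
  assumes "v \<in> carrier M"
  obtains f where "f \<in> borel_measurable m" "pnorm M v = ae_class m f" "AE x in m. 0 \<le> f x"
proof -
  obtain f where f: "f \<in> borel_measurable m" "pnorm M v = ae_class m f"
    using L0_cases[OF pnorm_closed[OF assms]] by blast
  then have "AE x in m. 0 \<le> f x"
    using pnorm_nonneg[OF assms] by (simp add: L0_simps L0_le_ae_class)
  with f that show ?thesis by blast
qed

lemma (in pointwise_normed_module) smult_uminus_one: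
  assumes "v \<in> carrier M"
  shows "ae_class m (\<lambda>x. -1) \<odot>\<^bsub>M\<^esub> v = \<ominus>\<^bsub>M\<^esub> v"
proof -
  let ?F = "ae_class m (\<lambda>x. -1)"
  have F: "?F \<in> carrier (L0 m)" by (simp add: L0_closed)
  have "?F \<oplus>\<^bsub>L0 m\<^esub> \<one>\<^bsub>L0 m\<^esub> = \<zero>\<^bsub>L0 m\<^esub>" by (simp add: L0_simps)
  then have "?F \<odot>\<^bsub>M\<^esub> v \<oplus>\<^bsub>M\<^esub> v = \<zero>\<^bsub>M\<^esub>"
    using smult_l_distr[of ?F "\<one>\<^bsub>L0 m\<^esub>" v] F assms by simp
  then show ?thesis using assms F by (simp add: M.minus_equality)
qed

lemma (in pointwise_normed_module) pnorm_uminus: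
  assumes "v \<in> carrier M"
  shows "pnorm M (\<ominus>\<^bsub>M\<^esub> v) = pnorm M v"
proof -
  obtain f where f: "f \<in> borel_measurable m" "pnorm M v = ae_class m f"
    using pnorm_cases[OF assms] by blast
  have "pnorm M (\<ominus>\<^bsub>M\<^esub> v) = L0_abs m (ae_class m (\<lambda>x. -1)) \<otimes>\<^bsub>L0 m\<^esub> pnorm M v"
    using pnorm_smult[of "ae_class m (\<lambda>x. -1)" v] assms
    by (simp add: smult_uminus_one L0_closed)
  then show ?thesis using f by (simp add: L0_abs_ae_class L0_simps)
qed

lemma (in pointwise_normed_module) Metric_space_mod_dist:
  assumes sb: "sets m = sets borel" and ref: "reference_measure m m'"
  shows "Metric_space (carrier M) (mod_dist m' M)"
proof
  note int = L0_trunc_integral_ae_class[OF sb ref] and itg = trunc_integrable[OF sb ref]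
    and AEi = reference_measure_AE_iff[OF sb ref]
  fix v w
  show "0 \<le> mod_dist m' M v w"
  proof (cases "v \<in> carrier M \<and> w \<in> carrier M")
    case True
    then obtain f where f: "f \<in> borel_measurable m" "pnorm M (v \<ominus>\<^bsub>M\<^esub> w) = ae_class m f"
      "AE x in m. 0 \<le> f x" using pnorm_cases[of "v \<ominus>\<^bsub>M\<^esub> w"] by auto
    have "AE x in m'. 0 \<le> min (f x) 1" using f(3) unfolding AEi by eventually_elim simp
    then show ?thesis using True f by (simp add: mod_dist_def int integral_nonneg_AE)
  qed (auto simp: mod_dist_def)
  show "mod_dist m' M v w = mod_dist m' M w v"
  proof (cases "v \<in> carrier M \<and> w \<in> carrier M")
    case True
    then have "w \<ominus>\<^bsub>M\<^esub> v = \<ominus>\<^bsub>M\<^esub> (v \<ominus>\<^bsub>M\<^esub> w)"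
      by (simp add: M.minus_eq M.minus_add M.a_comm)
    then show ?thesis using True pnorm_uminus[of "v \<ominus>\<^bsub>M\<^esub> w"] by (simp add: mod_dist_def)
  qed (auto simp: mod_dist_def)
next
  note int = L0_trunc_integral_ae_class[OF sb ref] and itg = trunc_integrable[OF sb ref]
    and AEi = reference_measure_AE_iff[OF sb ref]
  fix v w assume vw: "v \<in> carrier M" "w \<in> carrier M"
  then obtain f where f: "f \<in> borel_measurable m" "pnorm M (v \<ominus>\<^bsub>M\<^esub> w) = ae_class m f"
      "AE x in m. 0 \<le> f x" using pnorm_cases[of "v \<ominus>\<^bsub>M\<^esub> w"] by auto
  have nn: "AE x in m'. 0 \<le> min (f x) 1" using f(3) unfolding AEi by eventually_elim simp
  have "mod_dist m' M v w = 0 \<longleftrightarrow> (AE x in m'. min (f x) 1 = 0)"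
    using vw f integral_nonneg_eq_0_iff_AE[OF itg[OF f(1,3)] nn] by (simp add: mod_dist_def int)
  also have "\<dots> \<longleftrightarrow> (AE x in m. f x = 0)"
    unfolding AEi by (rule arg_cong[where f="\<lambda>P. AE x in m. P x"]) (auto simp: min_def fun_eq_iff)
  also have "\<dots> \<longleftrightarrow> pnorm M (v \<ominus>\<^bsub>M\<^esub> w) = \<zero>\<^bsub>L0 m\<^esub>"
    using f by (simp add: L0_simps ae_class_eq_iff)
  also have "\<dots> \<longleftrightarrow> v = w"
    using vw
    by (simp add: pnorm_eq_zero)
      (metis M.minus_eq M.a_inv_closed M.minus_equality M.minus_minus M.r_neg)
  finally show "mod_dist m' M v w = 0 \<longleftrightarrow> v = w" .
next
  note int = L0_trunc_integral_ae_class[OF sb ref] and itg = trunc_integrable[OF sb ref]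
    and AEi = reference_measure_AE_iff[OF sb ref]
  fix u v w assume c: "u \<in> carrier M" "v \<in> carrier M" "w \<in> carrier M"
  obtain f where f: "f \<in> borel_measurable m" "pnorm M (u \<ominus>\<^bsub>M\<^esub> v) = ae_class m f"
      "AE x in m. 0 \<le> f x" using pnorm_cases[of "u \<ominus>\<^bsub>M\<^esub> v"] c by auto
  obtain g where g: "g \<in> borel_measurable m" "pnorm M (v \<ominus>\<^bsub>M\<^esub> w) = ae_class m g"
      "AE x in m. 0 \<le> g x" using pnorm_cases[of "v \<ominus>\<^bsub>M\<^esub> w"] c by auto
  obtain h where h: "h \<in> borel_measurable m" "pnorm M (u \<ominus>\<^bsub>M\<^esub> w) = ae_class m h"
      "AE x in m. 0 \<le> h x" using pnorm_cases[of "u \<ominus>\<^bsub>M\<^esub> w"] c by auto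
  have "(u \<ominus>\<^bsub>M\<^esub> v) \<oplus>\<^bsub>M\<^esub> (v \<ominus>\<^bsub>M\<^esub> w) = u \<ominus>\<^bsub>M\<^esub> w"
    using c by (simp add: M.minus_eq M.a_assoc M.r_neg1)
  then have "L0_le m (ae_class m h) (ae_class m (\<lambda>x. f x + g x))"
    using pnorm_triangle[of "u \<ominus>\<^bsub>M\<^esub> v" "v \<ominus>\<^bsub>M\<^esub> w"] c f g h by (simp add: L0_simps)
  then have hfg: "AE x in m. h x \<le> f x + g x"
    using f g h by (simp add: L0_le_ae_class)
  have "AE x in m'. min (h x) 1 \<le> min (f x) 1 + min (g x) 1"
    using hfg f(3) g(3) unfolding AEi by eventually_elim auto
  then have "(LINT x|m'. min (h x) 1) \<le> (LINT x|m'. min (f x) 1 + min (g x) 1)"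
    by (intro integral_mono_AE itg f g h Bochner_Integration.integrable_add)
  also have "\<dots> = (LINT x|m'. min (f x) 1) + (LINT x|m'. min (g x) 1)"
    by (intro Bochner_Integration.integral_add itg f g)
  finally show "mod_dist m' M u w \<le> mod_dist m' M u v + mod_dist m' M v w"
    using c f g h by (simp add: mod_dist_def int)
qed


section \<open>Independence of the type of the test objects\<close>

lemma mcomplete_iff:
  assumes "Metric_space M d"
  shows "Metric_space.mcomplete M d \<longleftrightarrow>
    (\<forall>\<sigma>. range \<sigma> \<subseteq> M \<longrightarrow> (\<forall>e>0. \<exists>N. \<forall>n n'. N \<le> n \<longrightarrow> N \<le> n' \<longrightarrow> d (\<sigma> n) (\<sigma> n') < e) \<longrightarrow>
      (\<exists>x. limitin (Metric_space.mtopology M d) \<sigma> x sequentially))"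
  using assms by (auto simp: Metric_space.mcomplete_def Metric_space.MCauchy_def)

lemma closed_submodule_copy:
  fixes m m' :: "'x::polish_space measure" and N :: "('x, 'w) nmodule" and c :: "'w \<Rightarrow> 'u"
  assumes sb: "sets m = sets borel" and ref: "reference_measure m m'"
    and N: "normed_L0_module m m' N"
    and ne: "H \<noteq> {}" and sub: "H \<subseteq> carrier N"
    and add: "\<And>x y. x \<in> H \<Longrightarrow> y \<in> H \<Longrightarrow> x \<oplus>\<^bsub>N\<^esub> y \<in> H"
    and sm: "\<And>F x. F \<in> carrier (L0 m) \<Longrightarrow> x \<in> H \<Longrightarrow> F \<odot>\<^bsub>N\<^esub> x \<in> H"
    and lim: "\<And>\<sigma> x. range \<sigma> \<subseteq> H \<Longrightarrow>
                limitin (Metric_space.mtopology (carrier N) (mod_dist m' N)) \<sigma> x sequentially \<Longrightarrow> x \<in> H"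
    and inj: "inj_on c H"
  obtains N' :: "('x, 'u) nmodule" and j where "normed_L0_module m m' N'"
    "j \<in> normed_morphisms m N' N" "inj_on j (carrier N')" "j ` carrier N' = H"
    "\<And>v. v \<in> carrier N' \<Longrightarrow> pnorm N (j v) = pnorm N' v"
proof -
  interpret N: normed_L0_module m m' N by (rule N)
  define k where "k = inv_into H c"
  have kc[simp]: "k (c x) = x" if "x \<in> H" for x using that inj by (simp add: k_def)
  have ck[simp]: "c (k a) = a" if "a \<in> c ` H" for a using that by auto
  have kH: "k a \<in> H" if "a \<in> c ` H" for a using that by auto
  have kN[simp]: "k a \<in> carrier N" if "a \<in> c ` H" for a using kH[OF that] sub by auto
  have m1: "ae_class m (\<lambda>x. -1) \<in> carrier (L0 m)" by (rule L0_closed) simp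
  obtain h where h: "h \<in> H" using ne by blast
  have z: "\<zero>\<^bsub>N\<^esub> \<in> H"
    using sm[OF N.R.zero_closed h] h sub by auto
  have neg: "\<ominus>\<^bsub>N\<^esub> x \<in> H" if "x \<in> H" for x
    using sm[OF m1 that] that sub by (auto simp: N.smult_uminus_one)
  define N' :: "('x, 'u) nmodule" where
    "N' = \<lparr>carrier = c ` H, mult = undefined, one = undefined, zero = c \<zero>\<^bsub>N\<^esub>,
           add = (\<lambda>a b. c (k a \<oplus>\<^bsub>N\<^esub> k b)), smult = (\<lambda>F a. c (F \<odot>\<^bsub>N\<^esub> k a)),
           pnorm = (\<lambda>a. pnorm N (k a))\<rparr>"
  have s[simp]: "carrier N' = c ` H" "\<zero>\<^bsub>N'\<^esub> = c \<zero>\<^bsub>N\<^esub>" "a \<oplus>\<^bsub>N'\<^esub> b = c (k a \<oplus>\<^bsub>N\<^esub> k b)"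
    "F \<odot>\<^bsub>N'\<^esub> a = c (F \<odot>\<^bsub>N\<^esub> k a)" "pnorm N' a = pnorm N (k a)" for a b F
    by (simp_all add: N'_def)
  note cl = add sm kH z neg
  have ab: "abelian_group N'"
  proof (rule abelian_groupI)
    fix a assume a: "a \<in> carrier N'"
    then show "\<exists>b\<in>carrier N'. b \<oplus>\<^bsub>N'\<^esub> a = \<zero>\<^bsub>N'\<^esub>"
      by (intro bexI[of _ "c (\<ominus>\<^bsub>N\<^esub> k a)"]) (simp_all add: cl N.M.l_neg)
  next
    fix a b assume "a \<in> carrier N'" "b \<in> carrier N'"
    then show "a \<oplus>\<^bsub>N'\<^esub> b = b \<oplus>\<^bsub>N'\<^esub> a"
      by (simp add: N.M.a_comm)
  next
    fix a b e assume "a \<in> carrier N'" "b \<in> carrier N'" "e \<in> carrier N'"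
    then show "(a \<oplus>\<^bsub>N'\<^esub> b) \<oplus>\<^bsub>N'\<^esub> e = a \<oplus>\<^bsub>N'\<^esub> (b \<oplus>\<^bsub>N'\<^esub> e)"
      by (simp add: cl N.M.a_assoc)
  qed (simp_all add: cl)
  have mod: "module (L0 m) N'"
  proof (rule moduleI[OF cring_L0 ab])
    fix F G a assume "F \<in> carrier (L0 m)" "G \<in> carrier (L0 m)" "a \<in> carrier N'"
    then show "(F \<oplus>\<^bsub>L0 m\<^esub> G) \<odot>\<^bsub>N'\<^esub> a = F \<odot>\<^bsub>N'\<^esub> a \<oplus>\<^bsub>N'\<^esub> G \<odot>\<^bsub>N'\<^esub> a"
      and "(F \<otimes>\<^bsub>L0 m\<^esub> G) \<odot>\<^bsub>N'\<^esub> a = F \<odot>\<^bsub>N'\<^esub> (G \<odot>\<^bsub>N'\<^esub> a)"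
      by (simp_all add: cl N.smult_l_distr N.smult_assoc1)
  next
    fix F a b assume "F \<in> carrier (L0 m)" "a \<in> carrier N'" "b \<in> carrier N'"
    then show "F \<odot>\<^bsub>N'\<^esub> (a \<oplus>\<^bsub>N'\<^esub> b) = F \<odot>\<^bsub>N'\<^esub> a \<oplus>\<^bsub>N'\<^esub> F \<odot>\<^bsub>N'\<^esub> b"
      by (simp add: cl N.smult_r_distr)
  qed (simp_all add: cl)
  interpret N': pointwise_normed_module m N'
  proof (intro pointwise_normed_module.intro[OF mod] pointwise_normed_module_axioms.intro)
    fix a assume a: "a \<in> carrier N'"
    have "k a = \<zero>\<^bsub>N\<^esub> \<longleftrightarrow> a = c \<zero>\<^bsub>N\<^esub>" using a z by (metis ck kc s(1))
    then show "pnorm N' a = \<zero>\<^bsub>L0 m\<^esub> \<longleftrightarrow> a = \<zero>\<^bsub>N'\<^esub>"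
      using a by (simp add: N.pnorm_eq_zero)
  qed (simp_all add: cl N.pnorm_closed N.pnorm_nonneg N.pnorm_triangle N.pnorm_smult)
  have dist: "mod_dist m' N' a b = mod_dist m' N (k a) (k b)" if "a \<in> c ` H" "b \<in> c ` H" for a b
  proof -
    have "\<ominus>\<^bsub>N'\<^esub> b = c (\<ominus>\<^bsub>N\<^esub> k b)"
      using N'.smult_uminus_one[of b] that by (simp add: N.smult_uminus_one)
    then show ?thesis using that by (simp add: mod_dist_def N'.M.minus_eq N.M.minus_eq cl)
  qed
  have MN: "Metric_space (carrier N) (mod_dist m' N)"
    by (rule N.Metric_space_mod_dist[OF sb ref])
  have MN': "Metric_space (carrier N') (mod_dist m' N')"
    by (rule N'.Metric_space_mod_dist[OF sb ref])
  have "Metric_space.mcomplete (carrier N') (mod_dist m' N')"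
    unfolding mcomplete_iff[OF MN']
  proof (intro allI impI)
    fix \<sigma> :: "nat \<Rightarrow> 'u" assume \<sigma>: "range \<sigma> \<subseteq> carrier N'"
      and C: "\<forall>e>0. \<exists>n0. \<forall>n n'. n0 \<le> n \<longrightarrow> n0 \<le> n' \<longrightarrow> mod_dist m' N' (\<sigma> n) (\<sigma> n') < e"
    have \<sigma>': "\<sigma> n \<in> c ` H" for n using \<sigma> by auto
    have "range (k \<circ> \<sigma>) \<subseteq> carrier N" using \<sigma>' by auto
    moreover have "\<forall>e>0. \<exists>n0. \<forall>n n'. n0 \<le> n \<longrightarrow> n0 \<le> n' \<longrightarrow>
        mod_dist m' N ((k \<circ> \<sigma>) n) ((k \<circ> \<sigma>) n') < e"
      using C by (simp add: dist[OF \<sigma>' \<sigma>'])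
    ultimately obtain x where
      x: "limitin (Metric_space.mtopology (carrier N) (mod_dist m' N)) (k \<circ> \<sigma>) x sequentially"
      using N.complete unfolding mcomplete_iff[OF MN] by blast
    have xH: "x \<in> H" using lim[OF _ x] kH[OF \<sigma>'] by auto
    have "limitin (Metric_space.mtopology (carrier N') (mod_dist m' N')) \<sigma> (c x) sequentially"
      using x xH \<sigma>' unfolding Metric_space.limit_metric_sequentially[OF MN]
        Metric_space.limit_metric_sequentially[OF MN'] by (simp add: dist)
    then show "\<exists>x. limitin (Metric_space.mtopology (carrier N') (mod_dist m' N')) \<sigma> x sequentially"
      by blast
  qed
  then have nm: "normed_L0_module m m' N'"
    by (intro normed_L0_module.intro normed_L0_module_axioms.intro N'.pointwise_normed_module_axioms)
  let ?j = "restrict k (c ` H)"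
  have "L0_le m F F" if "F \<in> carrier (L0 m)" for F
    using that by (auto elim!: L0_cases simp: L0_le_ae_class)
  then have "?j \<in> normed_morphisms m N' N"
    by (auto simp: normed_morphisms_def cl N.pnorm_closed subsetD[OF sub])
  moreover have "inj_on ?j (carrier N')" by (auto simp: inj_on_def)
  moreover have "?j ` carrier N' = H" by (force simp: kH)
  ultimately show thesis using that[OF nm, of ?j] by auto
qed

text \<open>Terms for the elements of the closed submodule generated by a family of elements
  indexed by \<open>'a\<close>; they bound its cardinality.\<close>

datatype ('a, 's) limit_term =
    Leaf 'a
  | Plus "('a, 's) limit_term" "('a, 's) limit_term"
  | Scal 's "('a, 's) limit_term"
  | Lim "nat \<Rightarrow> ('a, 's) limit_term"

inductive term_value ::
    "'x::polish_space measure \<Rightarrow> 'x measure \<Rightarrow> ('x, 'w) nmodule \<Rightarrow> 'a set \<Rightarrow> ('a \<Rightarrow> 'w) \<Rightarrow>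
     ('a, ('x \<Rightarrow> real) set) limit_term \<Rightarrow> 'w \<Rightarrow> bool"
  for m m' N A f where
    leaf: "a \<in> A \<Longrightarrow> term_value m m' N A f (Leaf a) (f a)"
  | plus: "term_value m m' N A f s x \<Longrightarrow> term_value m m' N A f t y \<Longrightarrow>
             term_value m m' N A f (Plus s t) (x \<oplus>\<^bsub>N\<^esub> y)"
  | scal: "F \<in> carrier (L0 m) \<Longrightarrow> term_value m m' N A f t x \<Longrightarrow>
             term_value m m' N A f (Scal F t) (F \<odot>\<^bsub>N\<^esub> x)"
  | lim: "(\<And>n. term_value m m' N A f (T n) (\<sigma> n)) \<Longrightarrow>
            limitin (Metric_space.mtopology (carrier N) (mod_dist m' N)) \<sigma> x sequentially \<Longrightarrow>
            term_value m m' N A f (Lim T) x"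

lemma small_submodule:
  fixes m m' :: "'x::polish_space measure" and N :: "('x, 'w) nmodule" and f :: "'a \<Rightarrow> 'w"
  assumes sb: "sets m = sets borel" and ref: "reference_measure m m'"
    and N: "normed_L0_module m m' N" and f: "f \<in> A \<rightarrow> carrier N" and ne: "A \<noteq> {}"
  obtains N' :: "('x, ('a, ('x \<Rightarrow> real) set) limit_term) nmodule" and j
  where "normed_L0_module m m' N'"
    "j \<in> normed_morphisms m N' N" "inj_on j (carrier N')" "f ` A \<subseteq> j ` carrier N'"
    "\<And>v. v \<in> carrier N' \<Longrightarrow> pnorm N (j v) = pnorm N' v"
proof -
  interpret N: normed_L0_module m m' N by (rule N)
  have MN: "Metric_space (carrier N) (mod_dist m' N)"
    by (rule N.Metric_space_mod_dist[OF sb ref])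
  let ?v = "term_value m m' N A f"
  have in_car: "x \<in> carrier N" if "?v t x" for t x
    using that f by induction (auto simp: Metric_space.limit_metric_sequentially[OF MN])
  have uniq: "?v t y \<Longrightarrow> x = y" if "?v t x" for t x y
    using that
  proof (induction arbitrary: y)
    case (leaf a) then show ?case by (auto elim: term_value.cases)
  next
    case (plus s x t y' y)
    from plus.prems plus.IH show ?case by (cases rule: term_value.cases) auto
  next
    case (scal F t x)
    from scal.prems scal.IH show ?case by (cases rule: term_value.cases) auto
  next
    case (lim T \<sigma> x)
    from lim.prems show ?case
    proof (cases rule: term_value.cases)
      case (lim \<sigma>')
      then have "\<sigma> = \<sigma>'" using lim.IH by auto
      with lim(2) \<open>limitin _ \<sigma> x sequentially\<close> show ?thesis
        using Metric_space.limitin_metric_unique[OF MN] trivial_limit_sequentially by blast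
    qed
  qed
  define H where "H = {x. \<exists>t. ?v t x}"
  define c where "c = (\<lambda>x. SOME t. ?v t x)"
  have c: "?v (c x) x" if "x \<in> H" for x using that unfolding H_def c_def by (auto intro: someI_ex)
  have "inj_on c H" using c uniq by (metis inj_onI)
  have fA: "f ` A \<subseteq> H" by (auto simp: H_def intro: term_value.leaf)
  obtain N' :: "('x, ('a, ('x \<Rightarrow> real) set) limit_term) nmodule" and j where
    "normed_L0_module m m' N'" "j \<in> normed_morphisms m N' N"
    "inj_on j (carrier N')" "j ` carrier N' = H"
    "\<And>v. v \<in> carrier N' \<Longrightarrow> pnorm N (j v) = pnorm N' v"
  proof (rule closed_submodule_copy[OF sb ref N _ _ _ _ _ \<open>inj_on c H\<close>])
    show "H \<noteq> {}" using fA ne by auto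
    show "H \<subseteq> carrier N" using in_car by (auto simp: H_def)
    show "x \<oplus>\<^bsub>N\<^esub> y \<in> H" if "x \<in> H" "y \<in> H" for x y
      using that by (auto simp: H_def intro: term_value.plus)
    show "F \<odot>\<^bsub>N\<^esub> x \<in> H" if "F \<in> carrier (L0 m)" "x \<in> H" for F x
      using that by (auto simp: H_def intro: term_value.scal)
    show "x \<in> H" if "range \<sigma> \<subseteq> H"
      "limitin (Metric_space.mtopology (carrier N) (mod_dist m' N)) \<sigma> x sequentially" for \<sigma> x
    proof -
      have "?v (Lim (\<lambda>n. c (\<sigma> n))) x"
        by (rule term_value.lim[OF _ that(2)]) (use that(1) c in auto)
      then show ?thesis by (auto simp: H_def)
    qed
  qed blast
  with fA that show thesis by blast
qed

lemma normed_morphisms_compose: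
  assumes K: "pointwise_normed_module m K" and M: "pointwise_normed_module m M"
    and N: "pointwise_normed_module m N"
    and \<phi>: "\<phi> \<in> normed_morphisms m K M" and \<psi>: "\<psi> \<in> normed_morphisms m M N"
  shows "compose (carrier K) \<psi> \<phi> \<in> normed_morphisms m K N"
proof -
  interpret K: pointwise_normed_module m K by fact
  interpret M: pointwise_normed_module m M by fact
  interpret N: pointwise_normed_module m N by fact
  have \<phi>c: "\<phi> v \<in> carrier M" if "v \<in> carrier K" for v
    using that \<phi> by (auto simp: normed_morphisms_def)
  have \<psi>c: "\<psi> v \<in> carrier N" if "v \<in> carrier M" for v
    using that \<psi> by (auto simp: normed_morphisms_def)
  have "L0_le m (pnorm N (\<psi> (\<phi> v))) (pnorm K v)" if v: "v \<in> carrier K" for v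
  proof -
    obtain f where f: "f \<in> borel_measurable m" "pnorm K v = ae_class m f"
      using K.pnorm_cases[OF v] by blast
    obtain g where g: "g \<in> borel_measurable m" "pnorm M (\<phi> v) = ae_class m g"
      using M.pnorm_cases[OF \<phi>c[OF v]] by blast
    obtain h where h: "h \<in> borel_measurable m" "pnorm N (\<psi> (\<phi> v)) = ae_class m h"
      using N.pnorm_cases[OF \<psi>c[OF \<phi>c[OF v]]] by blast
    have "AE x in m. g x \<le> f x" "AE x in m. h x \<le> g x"
      using \<phi> \<psi> v \<phi>c[OF v] f g h by (auto simp: normed_morphisms_def L0_le_ae_class)
    then have "AE x in m. h x \<le> f x" by eventually_elim simp
    then show ?thesis using f h by (simp add: L0_le_ae_class)
  qed
  then show ?thesis
    using \<phi> \<psi> \<phi>c \<psi>c by (auto simp: normed_morphisms_def compose_def)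
qed

lemma normed_morphisms_lift:
  assumes K: "pointwise_normed_module m K" and N': "pointwise_normed_module m N'"
    and j: "j \<in> normed_morphisms m N' N" "inj_on j (carrier N')"
    and iso: "\<And>v. v \<in> carrier N' \<Longrightarrow> pnorm N (j v) = pnorm N' v"
    and \<Phi>: "\<Phi> \<in> normed_morphisms m K N" and im: "\<Phi> ` carrier K \<subseteq> j ` carrier N'"
  obtains \<Psi> where "\<Psi> \<in> normed_morphisms m K N'" "compose (carrier K) j \<Psi> = \<Phi>"
proof -
  interpret K: pointwise_normed_module m K by fact
  interpret N': pointwise_normed_module m N' by fact
  define \<Psi> where "\<Psi> = (\<lambda>v\<in>carrier K. inv_into (carrier N') j (\<Phi> v))"
  have c: "\<Psi> v \<in> carrier N'" if "v \<in> carrier K" for v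
    using that im by (auto simp: \<Psi>_def intro!: inv_into_into)
  have e: "j (\<Psi> v) = \<Phi> v" if "v \<in> carrier K" for v
    using that im by (auto simp: \<Psi>_def intro!: f_inv_into_f)
  have "\<Psi> (v \<oplus>\<^bsub>K\<^esub> w) = \<Psi> v \<oplus>\<^bsub>N'\<^esub> \<Psi> w" if "v \<in> carrier K" "w \<in> carrier K" for v w
    using that c e j(1) \<Phi> by (intro inj_onD[OF j(2)]) (auto simp: normed_morphisms_def)
  moreover have "\<Psi> (F \<odot>\<^bsub>K\<^esub> v) = F \<odot>\<^bsub>N'\<^esub> \<Psi> v" if "F \<in> carrier (L0 m)" "v \<in> carrier K" for F v
    using that c e j(1) \<Phi> by (intro inj_onD[OF j(2)]) (auto simp: normed_morphisms_def)
  moreover have "L0_le m (pnorm N' (\<Psi> v)) (pnorm K v)" if "v \<in> carrier K" for v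
    using that c e \<Phi> iso[symmetric] by (auto simp: normed_morphisms_def)
  moreover have "\<Psi> \<in> carrier K \<rightarrow>\<^sub>E carrier N'" using c by (auto simp: \<Psi>_def)
  ultimately have "\<Psi> \<in> normed_morphisms m K N'" by (simp add: normed_morphisms_def)
  moreover have "compose (carrier K) j \<Psi> = \<Phi>"
    using e \<Phi> by (intro ext) (auto simp: compose_def normed_morphisms_def PiE_def extensional_def)
  ultimately show thesis by (rule that)
qed

theorem is_direct_limit_any_type:
  fixes m m' :: "'x::polish_space measure" and D :: "'i \<Rightarrow> ('x, 'v) nmodule"
    and L :: "('x, 'l) nmodule"
  assumes sb: "sets m = sets borel" and ref: "reference_measure m m'"
    and sys: "direct_system m m' I r D \<phi>"
    and lim: "is_direct_limit TYPE(('i \<times> 'v + 'l \<times> bool, ('x \<Rightarrow> real) set) limit_term)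
                m m' I r D \<phi> L \<iota>"
  shows "is_direct_limit TYPE('w) m m' I r D \<phi> L \<iota>"
proof -
  have tL: "is_target m m' I r D \<phi> L \<iota>" using lim by (simp add: is_direct_limit_def)
  have rI: "r \<subseteq> I \<times> I" and Ine: "I \<noteq> {}"
    using sys by (auto simp: direct_system_def directed_poset_def partial_order_on_def preorder_on_def)
  have pn: "normed_L0_module m m' K \<Longrightarrow> pointwise_normed_module m K" for K :: "('x, 'k) nmodule"
    by (simp add: normed_L0_module_def)
  have pD: "pointwise_normed_module m (D i)" if "i \<in> I" for i
    using that sys by (auto simp: direct_system_def normed_L0_module_def)
  have nL: "pointwise_normed_module m L"
    using tL by (auto simp: is_target_def normed_L0_module_def)
  then interpret L: pointwise_normed_module m L .
  have \<iota>: "\<iota> i \<in> normed_morphisms m (D i) L" if "i \<in> I" for i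
    using tL that by (auto simp: is_target_def)
  have "\<exists>!\<Phi>. \<Phi> \<in> normed_morphisms m L N \<and> (\<forall>i\<in>I. compose (carrier (D i)) \<Phi> (\<iota> i) = \<psi> i)"
    if tN: "is_target m m' I r D \<phi> N \<psi>" for N :: "('x, 'w) nmodule" and \<psi>
  proof -
    have N: "normed_L0_module m m' N" using tN by (simp add: is_target_def)
    have \<psi>: "\<psi> i \<in> normed_morphisms m (D i) N" if "i \<in> I" for i
      using tN that by (auto simp: is_target_def)
    have lift: "\<exists>\<psi>'. is_target m m' I r D \<phi> N' \<psi>' \<and> (\<forall>i\<in>I. compose (carrier (D i)) j (\<psi>' i) = \<psi> i)"
      if N': "normed_L0_module m m' N'" and j: "j \<in> normed_morphisms m N' N" "inj_on j (carrier N')"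
        and iso: "\<And>v. v \<in> carrier N' \<Longrightarrow> pnorm N (j v) = pnorm N' v"
        and im: "\<And>i. i \<in> I \<Longrightarrow> \<psi> i ` carrier (D i) \<subseteq> j ` carrier N'"
      for N' :: "('x, ('i \<times> 'v + 'l \<times> bool, ('x \<Rightarrow> real) set) limit_term) nmodule" and j
    proof -
      have "\<exists>\<Psi>. \<Psi> \<in> normed_morphisms m (D i) N' \<and> compose (carrier (D i)) j \<Psi> = \<psi> i"
        if "i \<in> I" for i
        using normed_morphisms_lift[OF pD[OF that] pn[OF N'] j iso \<psi>[OF that] im[OF that]] by blast
      then obtain \<psi>' where \<psi>': "\<And>i. i \<in> I \<Longrightarrow> \<psi>' i \<in> normed_morphisms m (D i) N'"
        "\<And>i. i \<in> I \<Longrightarrow> compose (carrier (D i)) j (\<psi>' i) = \<psi> i" by metis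
      have "compose (carrier (D i)) (\<psi>' k) (\<phi> i k) = \<psi>' i" if ik: "(i, k) \<in> r" for i k
      proof
        fix v
        have i: "i \<in> I" and k: "k \<in> I" using ik rI by auto
        have \<phi>ik: "\<phi> i k \<in> carrier (D i) \<rightarrow> carrier (D k)"
          using sys ik by (auto simp: direct_system_def normed_morphisms_def)
        show "compose (carrier (D i)) (\<psi>' k) (\<phi> i k) v = \<psi>' i v"
        proof (cases "v \<in> carrier (D i)")
          case True
          have "compose (carrier (D i)) (\<psi> k) (\<phi> i k) v = \<psi> i v"
            using tN ik by (auto simp: is_target_def)
          then have "\<psi> k (\<phi> i k v) = \<psi> i v" using True by (simp add: compose_def)
          moreover have "\<psi> k (\<phi> i k v) = j (\<psi>' k (\<phi> i k v))" "\<psi> i v = j (\<psi>' i v)"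
            using \<psi>'(2)[OF k, symmetric] \<psi>'(2)[OF i, symmetric] True \<phi>ik
            by (auto simp: compose_def)
          ultimately have "j (\<psi>' k (\<phi> i k v)) = j (\<psi>' i v)" by simp
          moreover have "\<psi>' k (\<phi> i k v) \<in> carrier N'" "\<psi>' i v \<in> carrier N'"
            using \<psi>'(1)[OF k] \<psi>'(1)[OF i] True \<phi>ik by (auto simp: normed_morphisms_def)
          ultimately show ?thesis using j(2) True by (auto simp: compose_def dest: inj_onD)
        next
          case False
          then show ?thesis using \<psi>'(1)[OF i]
            by (auto simp: compose_def normed_morphisms_def PiE_def extensional_def)
        qed
      qed
      then show ?thesis using N' \<psi>' by (intro exI[of _ \<psi>']) (auto simp: is_target_def)
    qed
    show ?thesis
    proof (rule ex_ex1I)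
      define A :: "('i \<times> 'v + 'l \<times> bool) set" where "A = Inl ` (SIGMA i:I. carrier (D i))"
      define f where "f = case_sum (\<lambda>(i, v). \<psi> i v) (\<lambda>(_::'l \<times> bool). undefined)"
      obtain i0 where i0: "i0 \<in> I" using Ine by blast
      interpret D0: pointwise_normed_module m "D i0" by (rule pD[OF i0])
      have "A \<noteq> {}" using i0 D0.M.zero_closed by (auto simp: A_def)
      moreover have "f \<in> A \<rightarrow> carrier N"
        using \<psi> by (fastforce simp: A_def f_def normed_morphisms_def)
      ultimately obtain N' :: "('x, ('i \<times> 'v + 'l \<times> bool, ('x \<Rightarrow> real) set) limit_term) nmodule" and j
        where N': "normed_L0_module m m' N'" and j: "j \<in> normed_morphisms m N' N"
          "inj_on j (carrier N')" and im: "f ` A \<subseteq> j ` carrier N'"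
          and iso: "\<And>v. v \<in> carrier N' \<Longrightarrow> pnorm N (j v) = pnorm N' v"
        using small_submodule[OF sb ref N] by metis
      have "\<psi> i ` carrier (D i) \<subseteq> j ` carrier N'" if "i \<in> I" for i
        using im that by (force simp: A_def f_def)
      then obtain \<psi>' where t': "is_target m m' I r D \<phi> N' \<psi>'"
        and j\<psi>: "\<And>i. i \<in> I \<Longrightarrow> compose (carrier (D i)) j (\<psi>' i) = \<psi> i"
        using lift[OF N' j iso] by blast
      obtain \<Phi> where \<Phi>: "\<Phi> \<in> normed_morphisms m L N'"
        "\<And>i. i \<in> I \<Longrightarrow> compose (carrier (D i)) \<Phi> (\<iota> i) = \<psi>' i"
        using lim t' unfolding is_direct_limit_def by blast
      have "compose (carrier (D i)) (compose (carrier L) j \<Phi>) (\<iota> i) = \<psi> i" if i: "i \<in> I" for i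
      proof
        fix v
        have \<iota>c: "\<iota> i v \<in> carrier L" if "v \<in> carrier (D i)"
          using \<iota>[OF i] that by (auto simp: normed_morphisms_def)
        have "compose (carrier (D i)) j (compose (carrier (D i)) \<Phi> (\<iota> i)) v = \<psi> i v"
          using j\<psi>[OF i] \<Phi>(2)[OF i] by simp
        then show "compose (carrier (D i)) (compose (carrier L) j \<Phi>) (\<iota> i) v = \<psi> i v"
          using \<iota>c by (simp add: compose_def split: if_splits)
      qed
      then show "\<exists>\<Phi>. \<Phi> \<in> normed_morphisms m L N \<and>
          (\<forall>i\<in>I. compose (carrier (D i)) \<Phi> (\<iota> i) = \<psi> i)"
        using normed_morphisms_compose[OF nL pn[OF N'] pn[OF N] \<Phi>(1) j(1)] by blast
    next
      fix \<Phi>1 \<Phi>2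
      assume "\<Phi>1 \<in> normed_morphisms m L N \<and> (\<forall>i\<in>I. compose (carrier (D i)) \<Phi>1 (\<iota> i) = \<psi> i)"
        and "\<Phi>2 \<in> normed_morphisms m L N \<and> (\<forall>i\<in>I. compose (carrier (D i)) \<Phi>2 (\<iota> i) = \<psi> i)"
      then have \<Phi>1: "\<Phi>1 \<in> normed_morphisms m L N"
          "\<And>i. i \<in> I \<Longrightarrow> compose (carrier (D i)) \<Phi>1 (\<iota> i) = \<psi> i"
        and \<Phi>2: "\<Phi>2 \<in> normed_morphisms m L N"
          "\<And>i. i \<in> I \<Longrightarrow> compose (carrier (D i)) \<Phi>2 (\<iota> i) = \<psi> i" by auto
      define A :: "('i \<times> 'v + 'l \<times> bool) set" where "A = Inr ` (carrier L \<times> UNIV)"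
      define f where
        "f = case_sum (\<lambda>(_::'i \<times> 'v). undefined) (\<lambda>(x, b). if b then \<Phi>1 x else \<Phi>2 x)"
      have "A \<noteq> {}" using L.M.zero_closed by (auto simp: A_def)
      moreover have "f \<in> A \<rightarrow> carrier N"
        using \<Phi>1(1) \<Phi>2(1) by (auto simp: A_def f_def normed_morphisms_def)
      ultimately obtain N' :: "('x, ('i \<times> 'v + 'l \<times> bool, ('x \<Rightarrow> real) set) limit_term) nmodule" and j
        where N': "normed_L0_module m m' N'" and j: "j \<in> normed_morphisms m N' N"
          "inj_on j (carrier N')" and im: "f ` A \<subseteq> j ` carrier N'"
          and iso: "\<And>v. v \<in> carrier N' \<Longrightarrow> pnorm N (j v) = pnorm N' v"
        using small_submodule[OF sb ref N] by metis
      have mem: "Inr (x, b) \<in> A" if "x \<in> carrier L" for x b using that by (auto simp: A_def)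
      have "\<Phi>1 x \<in> j ` carrier N'" "\<Phi>2 x \<in> j ` carrier N'" if "x \<in> carrier L" for x
        using im mem[OF that, of True] mem[OF that, of False] by (force simp: f_def)+
      then have im1: "\<Phi>1 ` carrier L \<subseteq> j ` carrier N'" and im2: "\<Phi>2 ` carrier L \<subseteq> j ` carrier N'"
        by auto
      obtain \<Psi>1 where \<Psi>1: "\<Psi>1 \<in> normed_morphisms m L N'" "compose (carrier L) j \<Psi>1 = \<Phi>1"
        using normed_morphisms_lift[OF nL pn[OF N'] j iso \<Phi>1(1) im1] by blast
      obtain \<Psi>2 where \<Psi>2: "\<Psi>2 \<in> normed_morphisms m L N'" "compose (carrier L) j \<Psi>2 = \<Phi>2"
        using normed_morphisms_lift[OF nL pn[OF N'] j iso \<Phi>2(1) im2] by blast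
      have \<iota>c: "\<iota> i v \<in> carrier L" if "i \<in> I" "v \<in> carrier (D i)" for i v
        using \<iota>[OF that(1)] that(2) by (auto simp: normed_morphisms_def)
      have \<Phi>\<iota>: "\<Phi>1 (\<iota> i v) = \<psi> i v" "\<Phi>2 (\<iota> i v) = \<psi> i v" if "i \<in> I" "v \<in> carrier (D i)" for i v
        using fun_cong[OF \<Phi>1(2)[OF that(1)], of v] fun_cong[OF \<Phi>2(2)[OF that(1)], of v] that(2)
        by (simp_all add: compose_def)
      have j\<Psi>: "j (\<Psi>1 x) = \<Phi>1 x" "j (\<Psi>2 x) = \<Phi>2 x" "\<Psi>1 x \<in> carrier N'" "\<Psi>2 x \<in> carrier N'"
        if "x \<in> carrier L" for x
        using that fun_cong[OF \<Psi>1(2), of x] fun_cong[OF \<Psi>2(2), of x] \<Psi>1(1) \<Psi>2(1)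
        by (auto simp: compose_def normed_morphisms_def)
      have "\<psi> i ` carrier (D i) \<subseteq> j ` carrier N'" if "i \<in> I" for i
      proof (rule image_subsetI)
        fix v assume "v \<in> carrier (D i)"
        then show "\<psi> i v \<in> j ` carrier N'"
          using that subsetD[OF im1 imageI[OF \<iota>c[of i v]]] \<Phi>\<iota>(1)[of i v] by simp
      qed
      then obtain \<psi>' where t': "is_target m m' I r D \<phi> N' \<psi>'"
        and j\<psi>: "\<And>i. i \<in> I \<Longrightarrow> compose (carrier (D i)) j (\<psi>' i) = \<psi> i"
        using lift[OF N' j iso] by blast
      have "compose (carrier (D i)) \<Psi> (\<iota> i) = \<psi>' i"
        if i: "i \<in> I" and \<Psi>: "\<Psi> = \<Psi>1 \<or> \<Psi> = \<Psi>2" for i \<Psi>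
      proof
        fix v
        have \<psi>'i: "\<psi>' i \<in> normed_morphisms m (D i) N'" using t' i by (simp add: is_target_def)
        show "compose (carrier (D i)) \<Psi> (\<iota> i) v = \<psi>' i v"
        proof (cases "v \<in> carrier (D i)")
          case True
          have "j (\<psi>' i v) = \<psi> i v" using fun_cong[OF j\<psi>[OF i], of v] True by (simp add: compose_def)
          moreover have "j (\<Psi> (\<iota> i v)) = \<psi> i v"
            using j\<Psi>[OF \<iota>c[OF i True]] \<Phi>\<iota>[OF i True] \<Psi> by auto
          moreover have "\<Psi> (\<iota> i v) \<in> carrier N'" using j\<Psi>[OF \<iota>c[OF i True]] \<Psi> by auto
          moreover have "\<psi>' i v \<in> carrier N'" using \<psi>'i True by (auto simp: normed_morphisms_def)
          ultimately show ?thesis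
            using inj_onD[OF j(2), of "\<Psi> (\<iota> i v)" "\<psi>' i v"] True by (simp add: compose_def)
        next
          case False
          then show ?thesis using \<psi>'i
            by (auto simp: compose_def normed_morphisms_def PiE_def extensional_def)
        qed
      qed
      moreover have "\<exists>!\<Phi>. \<Phi> \<in> normed_morphisms m L N' \<and>
          (\<forall>i\<in>I. compose (carrier (D i)) \<Phi> (\<iota> i) = \<psi>' i)"
        using lim t' by (simp add: is_direct_limit_def)
      ultimately have "\<Psi>1 = \<Psi>2" using \<Psi>1(1) \<Psi>2(1) by blast
      then show "\<Phi>1 = \<Phi>2" using \<Psi>1(2) \<Psi>2(2) by simp
    qed
  qed
  then show ?thesis using tL by (simp add: is_direct_limit_def)
qed

end

theory Submission
  imports Defs
begin

text \<open>The finite subsets \<open>S\<close> of a module \<open>M\<close>, ordered by inclusion, index the closed submodules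
  they generate, and \<open>M\<close> itself is the direct limit of this system of inclusions: any
  \<open>v\<close>, \<open>w\<close> lie in the submodule generated by \<open>{v, w, v \<oplus> w}\<close>, so \<open>v \<mapsto> \<psi> {v} v\<close> is the
  mediating morphism to a target with components \<open>\<psi>\<close>. No completion is needed because every
  element is already reached at a finite stage.\<close>

section \<open>Continuity of the module operations\<close>

text \<open>The distance is translation invariant because it depends only on the difference of its
  arguments. The bound then follows from the triangle inequality through the intermediate point
  \<open>a' \<oplus> b\<close>.\<close>

lemma (in pointwise_normed_module) mod_dist_add_le:
  assumes sb: "sets m = sets borel" and ref: "reference_measure m m'"
    and c: "a \<in> carrier M" "b \<in> carrier M" "a' \<in> carrier M" "b' \<in> carrier M"
  shows "mod_dist m' M (a \<oplus>\<^bsub>M\<^esub> b) (a' \<oplus>\<^bsub>M\<^esub> b') \<le> mod_dist m' M a a' + mod_dist m' M b b'"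
proof -
  interpret D: Metric_space "carrier M" "mod_dist m' M"
    by (rule Metric_space_mod_dist[OF sb ref])
  have trans: "mod_dist m' M (x \<oplus>\<^bsub>M\<^esub> z) (y \<oplus>\<^bsub>M\<^esub> z) = mod_dist m' M x y"
    if "x \<in> carrier M" "y \<in> carrier M" "z \<in> carrier M" for x y z
  proof -
    have "(x \<oplus>\<^bsub>M\<^esub> z) \<ominus>\<^bsub>M\<^esub> (y \<oplus>\<^bsub>M\<^esub> z) = x \<oplus>\<^bsub>M\<^esub> ((z \<oplus>\<^bsub>M\<^esub> \<ominus>\<^bsub>M\<^esub> z) \<oplus>\<^bsub>M\<^esub> \<ominus>\<^bsub>M\<^esub> y)"
      using that by (simp add: M.minus_eq M.minus_add M.a_ac del: M.r_neg M.l_neg)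
    also have "\<dots> = x \<ominus>\<^bsub>M\<^esub> y"
      using that by (simp add: M.minus_eq M.r_neg)
    finally show ?thesis using that by (simp add: mod_dist_def)
  qed
  have "mod_dist m' M (a \<oplus>\<^bsub>M\<^esub> b) (a' \<oplus>\<^bsub>M\<^esub> b')
      \<le> mod_dist m' M (a \<oplus>\<^bsub>M\<^esub> b) (a' \<oplus>\<^bsub>M\<^esub> b) + mod_dist m' M (a' \<oplus>\<^bsub>M\<^esub> b) (a' \<oplus>\<^bsub>M\<^esub> b')"
    using c by (intro D.triangle) auto
  also have "\<dots> = mod_dist m' M a a' + mod_dist m' M b b'"
    using c trans[of a a' b] trans[of b b' a'] by (simp add: M.a_comm[of b a'] M.a_comm[of b' a'])
  finally show ?thesis .
qed

text \<open>Off the set where \<open>\<bar>F\<bar> > n\<close>, which has small measure, multiplication by \<open>F\<close> increases the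
  truncated norm at most by the factor \<open>n\<close>.\<close>

lemma (in pointwise_normed_module) smult_continuous:
  assumes sb: "sets m = sets borel" and ref: "reference_measure m m'"
    and F: "F \<in> carrier (L0 m)" and e: "0 < e"
  obtains \<delta> where "0 < \<delta>"
    "\<And>v w. \<lbrakk>v \<in> carrier M; w \<in> carrier M; mod_dist m' M v w < \<delta>\<rbrakk>
      \<Longrightarrow> mod_dist m' M (F \<odot>\<^bsub>M\<^esub> v) (F \<odot>\<^bsub>M\<^esub> w) < e"
proof -
  interpret finite_measure m' by (rule reference_measure_finite[OF ref])
  note int = L0_trunc_integral_ae_class[OF sb ref] and itg = trunc_integrable[OF sb ref]
    and AEi = reference_measure_AE_iff[OF sb ref]
  have s: "sets m' = sets m" using sb ref by (simp add: reference_measure_def)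
  have sp: "space m' = UNIV" using sets_eq_imp_space_eq[OF s] sets_eq_imp_space_eq[OF sb] by simp
  obtain f where fm: "f \<in> borel_measurable m" and Ff: "F = ae_class m f"
    using F by (rule L0_cases)
  have [measurable]: "f \<in> borel_measurable m'"
    using fm by (simp cong: measurable_cong_sets[OF s refl])
  define A where "A n = {x \<in> space m'. real n < \<bar>f x\<bar>}" for n
  have A[measurable]: "A n \<in> sets m'" for n unfolding A_def by measurable
  \<comment> \<open>Since \<open>f\<close> is real-valued, the superlevel sets of its absolute value
    shrink to the empty set. The measure \<open>m'\<close> is finite, so their measures tend to
    0.\<close>
  have "decseq A" by (rule decseq_SucI) (auto simp: A_def)
  moreover have "(\<Inter>n. A n) = {}"
  proof -
    have "\<exists>n. x \<notin> A n" for x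
      using reals_Archimedean2[of "\<bar>f x\<bar>"] by (auto simp: A_def not_less intro: less_imp_le)
    then show ?thesis by blast
  qed
  ultimately have "(\<lambda>n. measure m' (A n)) \<longlonglongrightarrow> 0"
    using finite_Lim_measure_decseq[of A] A by (simp add: image_subset_iff)
  then have "\<forall>\<^sub>F n in sequentially. measure m' (A n) < e / 2"
    using e by (intro order_tendstoD) auto
  \<comment> \<open>The condition \<open>n \<ge> 1\<close> makes the radius
    \<open>e / (2 * n)\<close> meaningful. It also gives
    \<open>min (n * g x) 1 \<le> n * min (g x) 1\<close> at points where \<open>g x\<close> exceeds
    1.\<close>
  then obtain n where n: "n \<ge> 1" "measure m' (A n) < e / 2"
    unfolding eventually_sequentially by (metis nat_le_linear)
  \<comment> \<open>One half of \<open>e\<close> is spent on \<open>n\<close> times the original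
    distance, hence the radius \<open>e / (2 * n)\<close>. The other half covers \<open>A n\<close>,
    where the truncated norm is bounded only by 1.\<close>
  have "mod_dist m' M (F \<odot>\<^bsub>M\<^esub> v) (F \<odot>\<^bsub>M\<^esub> w) < e"
    if vw: "v \<in> carrier M" "w \<in> carrier M" and d: "mod_dist m' M v w < e / (2 * n)" for v w
  proof -
    obtain g where g: "g \<in> borel_measurable m" "pnorm M (v \<ominus>\<^bsub>M\<^esub> w) = ae_class m g"
      "AE x in m. 0 \<le> g x" using pnorm_cases[of "v \<ominus>\<^bsub>M\<^esub> w"] vw by auto
    have h: "(\<lambda>x. \<bar>f x\<bar> * g x) \<in> borel_measurable m" "AE x in m. 0 \<le> \<bar>f x\<bar> * g x"
      using fm g by auto
    have "F \<odot>\<^bsub>M\<^esub> v \<ominus>\<^bsub>M\<^esub> F \<odot>\<^bsub>M\<^esub> w = F \<odot>\<^bsub>M\<^esub> (v \<ominus>\<^bsub>M\<^esub> w)"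
      using vw F by (simp add: M.minus_eq smult_r_distr smult_r_minus)
    then have "pnorm M (F \<odot>\<^bsub>M\<^esub> v \<ominus>\<^bsub>M\<^esub> F \<odot>\<^bsub>M\<^esub> w) = ae_class m (\<lambda>x. \<bar>f x\<bar> * g x)"
      using vw F fm g by (simp add: pnorm_smult Ff L0_abs_ae_class L0_simps)
    then have "mod_dist m' M (F \<odot>\<^bsub>M\<^esub> v) (F \<odot>\<^bsub>M\<^esub> w) = (LINT x|m'. min (\<bar>f x\<bar> * g x) 1)"
      using vw F by (simp add: mod_dist_def int h)
    also have "\<dots> \<le> (LINT x|m'. n * min (g x) 1 + indicator (A n) x)"
    proof (intro integral_mono_AE itg h Bochner_Integration.integrable_add)
      show "integrable m' (\<lambda>x. n * min (g x) 1)" using itg[OF g(1,3)] by simp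
      show "AE x in m'. min (\<bar>f x\<bar> * g x) 1 \<le> n * min (g x) 1 + indicator (A n) x"
        using g(3) unfolding AEi
      proof eventually_elim
        case (elim x)
        show ?case
        proof (cases "\<bar>f x\<bar> \<le> n")
          case True
          then have "\<bar>f x\<bar> * g x \<le> n * g x" using elim by (rule mult_right_mono)
          then show ?thesis using n(1) by (auto simp: min_def indicator_def)
        next
          case False
          moreover have "0 \<le> n * min (g x) 1" using elim by simp
          ultimately show ?thesis by (simp add: A_def sp min_le_iff_disj)
        qed
      qed
    qed (simp_all add: integrable_indicator_iff less_top[symmetric])
    also have "\<dots> = n * mod_dist m' M v w + measure m' (A n)"
      using vw g itg[OF g(1,3)] by (simp add: mod_dist_def int integrable_indicator_iff less_top[symmetric])
    also have "\<dots> < n * (e / (2 * n)) + e / 2"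
      using n d by (intro add_strict_mono mult_strict_left_mono) auto
    also have "\<dots> = e" using n by simp
    finally show ?thesis .
  qed
  then show thesis using that[of "e / (2 * n)"] e n by auto
qed

section \<open>Closed submodules\<close>

text \<open>Each operation is continuous, so applying it to approximants from \<open>H\<close>
  approximates its value on limit points. Scalar multiplication comes first, because closure under
  negation is its special case with the constant -1.\<close>

lemma (in pointwise_normed_module) closure_of_submodule:
  assumes sb: "sets m = sets borel" and ref: "reference_measure m m'"
    and H: "submodule H (L0 m) M"
  shows "submodule (Metric_space.mtopology (carrier M) (mod_dist m' M) closure_of H) (L0 m) M"
    (is "submodule ?K _ _")
proof -
  interpret D: Metric_space "carrier M" "mod_dist m' M"
    by (rule Metric_space_mod_dist[OF sb ref])
  note HE = submoduleE[OF H]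
  have K: "x \<in> ?K \<longleftrightarrow> x \<in> carrier M \<and> (\<forall>e>0. \<exists>y\<in>H. mod_dist m' M x y < e)" for x
    using HE(1) by (auto simp: D.metric_closure_of D.in_mball subset_iff)
  then have KM: "?K \<subseteq> carrier M" by blast
  have HK: "H \<subseteq> ?K" using HE(1) by (intro closure_of_subset) simp
  have sm: "F \<odot>\<^bsub>M\<^esub> x \<in> ?K" if F: "F \<in> carrier (L0 m)" and x: "x \<in> ?K" for F x
    unfolding K
  proof (intro conjI allI impI)
    fix e :: real assume "0 < e"
    then obtain \<delta> where \<delta>: "0 < \<delta>"
      "\<And>v w. \<lbrakk>v \<in> carrier M; w \<in> carrier M; mod_dist m' M v w < \<delta>\<rbrakk>
        \<Longrightarrow> mod_dist m' M (F \<odot>\<^bsub>M\<^esub> v) (F \<odot>\<^bsub>M\<^esub> w) < e"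
      using smult_continuous[OF sb ref F] by blast
    then obtain y where "y \<in> H" "mod_dist m' M x y < \<delta>" using x K by blast
    then show "\<exists>y\<in>H. mod_dist m' M (F \<odot>\<^bsub>M\<^esub> x) y < e"
      using \<delta>(2)[of x y] HE(1) HE(4)[OF F] x K by blast
  qed (use F x KM in auto)
  show ?thesis
  proof (rule submoduleI)
    show "?K \<subseteq> carrier M" by (rule KM)
    show "\<zero>\<^bsub>M\<^esub> \<in> ?K"
      using HK H by (auto simp: submodule_def dest: subgroup.one_closed)
    show "\<ominus>\<^bsub>M\<^esub> a \<in> ?K" if a: "a \<in> ?K" for a
    proof -
      have "a \<in> carrier M" using a KM by blast
      then show ?thesis using sm[OF L0_closed a, of "\<lambda>x. -1"] by (simp add: smult_uminus_one)
    qed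
    show "a \<oplus>\<^bsub>M\<^esub> b \<in> ?K" if ab: "a \<in> ?K" "b \<in> ?K" for a b
      unfolding K
    proof (intro conjI allI impI)
      fix e :: real assume "0 < e"
      then have "0 < e / 2" by simp
      then obtain x y where xy: "x \<in> H" "mod_dist m' M a x < e / 2"
        "y \<in> H" "mod_dist m' M b y < e / 2" using ab[unfolded K] by meson
      have "x \<in> carrier M" "y \<in> carrier M" "a \<in> carrier M" "b \<in> carrier M"
        using xy HE(1) ab[unfolded K] by auto
      from mod_dist_add_le[OF sb ref this(3,4,1,2)]
      have "mod_dist m' M (a \<oplus>\<^bsub>M\<^esub> b) (x \<oplus>\<^bsub>M\<^esub> y) < e" using xy by simp
      then show "\<exists>z\<in>H. mod_dist m' M (a \<oplus>\<^bsub>M\<^esub> b) z < e" using HE(5) xy by blast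
    qed (use ab KM in auto)
  qed (rule sm)
qed

lemma (in pointwise_normed_module) pointwise_normed_submodule:
  assumes "submodule H (L0 m) M"
  shows "pointwise_normed_module m (M\<lparr>carrier := H\<rparr>)"
proof -
  have "module (L0 m) M" by unfold_locales
  then have "module (L0 m) (M\<lparr>carrier := H\<rparr>)"
    using submodule.submodule_is_module[OF assms] by blast
  then show ?thesis
    using submoduleE(1)[OF assms]
    by (intro pointwise_normed_module.intro pointwise_normed_module_axioms.intro)
      (auto simp: pnorm_closed pnorm_nonneg pnorm_triangle pnorm_smult pnorm_eq_zero subset_iff)
qed

text \<open>An additive inverse is singled out within the carrier, so shrinking the carrier could a
  priori change \<open>\<ominus>\<close> and with it the distance. In both modules it is
  multiplication by the class of -1, and that operation is shared.\<close>

lemma (in pointwise_normed_module) mod_dist_submodule: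
  assumes H: "submodule H (L0 m) M" and v: "v \<in> H" "w \<in> H"
  shows "mod_dist m' (M\<lparr>carrier := H\<rparr>) v w = mod_dist m' M v w"
proof -
  interpret H: pointwise_normed_module m "M\<lparr>carrier := H\<rparr>"
    by (rule pointwise_normed_submodule[OF H])
  have "\<ominus>\<^bsub>M\<lparr>carrier := H\<rparr>\<^esub> w = \<ominus>\<^bsub>M\<^esub> w"
    using H.smult_uminus_one[of w] smult_uminus_one[of w] v submoduleE(1)[OF H] by auto
  then show ?thesis
    using v submoduleE(1)[OF H] by (auto simp: mod_dist_def a_minus_def)
qed

text \<open>A Cauchy sequence in \<open>H\<close> is Cauchy in \<open>M\<close> because the
  distances agree. It converges there by completeness, and closedness keeps the limit in
  \<open>H\<close>.\<close>

lemma (in normed_L0_module) normed_L0_closed_submodule: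
  assumes sb: "sets m = sets borel" and ref: "reference_measure m m'"
    and H: "submodule H (L0 m) M"
    and cl: "closedin (Metric_space.mtopology (carrier M) (mod_dist m' M)) H"
  shows "normed_L0_module m m' (M\<lparr>carrier := H\<rparr>)"
proof -
  interpret D: Metric_space "carrier M" "mod_dist m' M"
    by (rule Metric_space_mod_dist[OF sb ref])
  interpret H: pointwise_normed_module m "M\<lparr>carrier := H\<rparr>"
    by (rule pointwise_normed_submodule[OF H])
  interpret DH: Metric_space "carrier (M\<lparr>carrier := H\<rparr>)" "mod_dist m' (M\<lparr>carrier := H\<rparr>)"
    by (rule H.Metric_space_mod_dist[OF sb ref])
  have sub: "H \<subseteq> carrier M" by (rule submoduleE(1)[OF H])
  note d = mod_dist_submodule[OF H]
  have "DH.mcomplete"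
    unfolding DH.mcomplete_def
  proof (intro allI impI)
    fix \<sigma> assume \<sigma>: "DH.MCauchy \<sigma>"
    then have r: "\<sigma> n \<in> H" for n unfolding DH.MCauchy_def by auto
    have "D.MCauchy \<sigma>"
      using \<sigma> sub unfolding DH.MCauchy_def D.MCauchy_def by (auto simp: d r)
    then obtain x where x: "limitin D.mtopology \<sigma> x sequentially"
      using complete by (auto simp: D.mcomplete_def)
    then have "x \<in> H" using cl r by (auto intro: limitin_closedin)
    then have "limitin DH.mtopology \<sigma> x sequentially"
      using x r unfolding D.limit_metric_sequentially DH.limit_metric_sequentially by (simp add: d) blast
    then show "\<exists>x. limitin DH.mtopology \<sigma> x sequentially" by blast
  qed
  then show ?thesis
    by (intro normed_L0_module.intro normed_L0_module_axioms.intro H.pointwise_normed_module_axioms)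
qed

section \<open>Generated submodules\<close>

text \<open>The new term is appended at index \<open>Suc n\<close>. This is the induction step for
  adding two combinations.\<close>

lemma (in pointwise_normed_module) L0_combinations_add_smult:
  assumes S: "S \<subseteq> carrier M"
    and x: "x \<in> L0_combinations m M S" and F: "F \<in> carrier (L0 m)" and v: "v \<in> S"
  shows "x \<oplus>\<^bsub>M\<^esub> F \<odot>\<^bsub>M\<^esub> v \<in> L0_combinations m M S"
proof -
  obtain n :: nat and G u where x: "x = (\<Oplus>\<^bsub>M\<^esub>k\<in>{1..n}. G k \<odot>\<^bsub>M\<^esub> u k)"
    and G: "G \<in> {1..n} \<rightarrow> carrier (L0 m)" and u: "u \<in> {1..n} \<rightarrow> S"
    using x by (auto simp: L0_combinations_def)
  let ?G = "G(Suc n := F)" and ?u = "u(Suc n := v)"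
  have ins: "{1..Suc n} = insert (Suc n) {1..n}" by auto
  have old: "(\<Oplus>\<^bsub>M\<^esub>k\<in>{1..n}. ?G k \<odot>\<^bsub>M\<^esub> ?u k) = x"
    unfolding x using G u S by (intro M.finsum_cong') auto
  have "(\<Oplus>\<^bsub>M\<^esub>k\<in>{1..Suc n}. ?G k \<odot>\<^bsub>M\<^esub> ?u k) = F \<odot>\<^bsub>M\<^esub> v \<oplus>\<^bsub>M\<^esub> x"
    using G u S F v old unfolding ins
    by (subst M.finsum_insert) (auto simp: Pi_iff subset_iff)
  moreover have "F \<odot>\<^bsub>M\<^esub> v \<in> carrier M" using F v S by auto
  moreover have "x \<in> carrier M" unfolding x using G u S by (intro M.finsum_closed) auto
  ultimately have "x \<oplus>\<^bsub>M\<^esub> F \<odot>\<^bsub>M\<^esub> v = (\<Oplus>\<^bsub>M\<^esub>k\<in>{1..Suc n}. ?G k \<odot>\<^bsub>M\<^esub> ?u k)"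
    by (simp add: M.a_comm)
  moreover have "?G \<in> {1..Suc n} \<rightarrow> carrier (L0 m)" "?u \<in> {1..Suc n} \<rightarrow> S"
    using G u F v by (auto simp: Pi_iff)
  ultimately show ?thesis unfolding L0_combinations_def by blast
qed

text \<open>A scalar is absorbed into the coefficients. For sums, the terms of the second
  combination are added to the first one at a time, by induction on their number, which avoids
  merging two index ranges.\<close>

lemma (in pointwise_normed_module) submodule_L0_combinations:
  assumes S: "S \<subseteq> carrier M"
  shows "submodule (L0_combinations m M S) (L0 m) M" (is "submodule ?C _ _")
proof -
  have sub: "?C \<subseteq> carrier M"
    using S by (auto simp: L0_combinations_def intro!: M.finsum_closed)
  have sm: "a \<odot>\<^bsub>M\<^esub> x \<in> ?C" if a: "a \<in> carrier (L0 m)" and "x \<in> ?C" for a x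
  proof -
    obtain n :: nat and G u where x: "x = (\<Oplus>\<^bsub>M\<^esub>k\<in>{1..n}. G k \<odot>\<^bsub>M\<^esub> u k)"
      and G: "G \<in> {1..n} \<rightarrow> carrier (L0 m)" and u: "u \<in> {1..n} \<rightarrow> S"
      using \<open>x \<in> ?C\<close> by (auto simp: L0_combinations_def)
    have "a \<odot>\<^bsub>M\<^esub> x = (\<Oplus>\<^bsub>M\<^esub>k\<in>{1..n}. a \<odot>\<^bsub>M\<^esub> (G k \<odot>\<^bsub>M\<^esub> u k))"
      unfolding x using a G u S by (intro finsum_smult_ldistr) auto
    also have "\<dots> = (\<Oplus>\<^bsub>M\<^esub>k\<in>{1..n}. (a \<otimes>\<^bsub>L0 m\<^esub> G k) \<odot>\<^bsub>M\<^esub> u k)"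
      using a G u S by (intro M.finsum_cong') (auto simp: smult_assoc1 Pi_iff subset_iff)
    finally show ?thesis using a G u unfolding L0_combinations_def by fastforce
  qed
  show ?thesis
  proof (rule submoduleI[OF sub])
    \<comment> \<open>The empty sum counts as a combination, so this holds even for empty
      \<open>S\<close>.\<close>
    show "\<zero>\<^bsub>M\<^esub> \<in> ?C"
      unfolding L0_combinations_def by (auto intro!: exI[of _ "0::nat"])
    show "\<ominus>\<^bsub>M\<^esub> a \<in> ?C" if "a \<in> ?C" for a
      using sm[of "ae_class m (\<lambda>x. -1)" a] that sub by (simp add: L0_closed smult_uminus_one subset_iff)
    show "a \<oplus>\<^bsub>M\<^esub> b \<in> ?C" if a: "a \<in> ?C" and b: "b \<in> ?C" for a b
    proof -
      have "a \<oplus>\<^bsub>M\<^esub> (\<Oplus>\<^bsub>M\<^esub>k\<in>{1..n}. G k \<odot>\<^bsub>M\<^esub> u k) \<in> ?C"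
        if "G \<in> {1..n} \<rightarrow> carrier (L0 m)" "u \<in> {1..n} \<rightarrow> S" for n :: nat and G u
        using that
      proof (induction n)
        case 0
        then show ?case using a sub by auto
      next
        case (Suc n)
        have ins: "{1..Suc n} = insert (Suc n) {1..n}" by auto
        have c: "(\<lambda>k. G k \<odot>\<^bsub>M\<^esub> u k) \<in> {1..n} \<rightarrow> carrier M" "G (Suc n) \<in> carrier (L0 m)"
          "u (Suc n) \<in> S" "u (Suc n) \<in> carrier M"
          using Suc.prems S by (auto simp: Pi_iff subset_iff)
        let ?s = "\<Oplus>\<^bsub>M\<^esub>k\<in>{1..n}. G k \<odot>\<^bsub>M\<^esub> u k" and ?t = "G (Suc n) \<odot>\<^bsub>M\<^esub> u (Suc n)"
        have "(\<Oplus>\<^bsub>M\<^esub>k\<in>{1..Suc n}. G k \<odot>\<^bsub>M\<^esub> u k) = ?t \<oplus>\<^bsub>M\<^esub> ?s"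
          using c unfolding ins by (subst M.finsum_insert) auto
        moreover have "?s \<in> carrier M" "?t \<in> carrier M" "a \<in> carrier M"
          using c a sub by (auto intro: M.finsum_closed)
        ultimately have "a \<oplus>\<^bsub>M\<^esub> (\<Oplus>\<^bsub>M\<^esub>k\<in>{1..Suc n}. G k \<odot>\<^bsub>M\<^esub> u k) = (a \<oplus>\<^bsub>M\<^esub> ?s) \<oplus>\<^bsub>M\<^esub> ?t"
          by (simp add: M.a_ac)
        moreover have "a \<oplus>\<^bsub>M\<^esub> ?s \<in> ?C" using Suc.prems by (intro Suc.IH) auto
        ultimately show ?case using L0_combinations_add_smult[OF S] c by simp
      qed
      then show ?thesis using b by (auto simp: L0_combinations_def)
    qed
  qed (rule sm)
qed

text \<open>Each \<open>v\<close> in \<open>S\<close> is the empty combination plus \<open>1\<close>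
  times \<open>v\<close>.\<close>

lemma (in pointwise_normed_module) L0_combinations_superset:
  assumes S: "S \<subseteq> carrier M"
  shows "S \<subseteq> L0_combinations m M S"
proof
  fix v assume v: "v \<in> S"
  have "\<zero>\<^bsub>M\<^esub> \<in> L0_combinations m M S"
    unfolding L0_combinations_def by (auto intro!: exI[of _ "0::nat"])
  then show "v \<in> L0_combinations m M S"
    using L0_combinations_add_smult[OF S _ R.one_closed v, of "\<zero>\<^bsub>M\<^esub>"] subsetD[OF S v] by simp
qed

text \<open>The operator \<open>finsum\<close> refers to the carrier as well as to addition, so the
  sums in the two modules are not equal by definition. Induction over the finite index set
  identifies them as long as all terms lie in \<open>H\<close>.\<close>

lemma (in pointwise_normed_module) L0_combinations_submodule:
  assumes H: "submodule H (L0 m) M" and S: "S \<subseteq> H"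
  shows "L0_combinations m (M\<lparr>carrier := H\<rparr>) S = L0_combinations m M S"
proof -
  interpret H: pointwise_normed_module m "M\<lparr>carrier := H\<rparr>"
    by (rule pointwise_normed_submodule[OF H])
  have sub: "H \<subseteq> carrier M" by (rule submoduleE(1)[OF H])
  have fs: "finsum (M\<lparr>carrier := H\<rparr>) f A = finsum M f A" if "finite A" "f \<in> A \<rightarrow> H" for f and A :: "nat set"
    using that
  proof induction
    case empty
    then show ?case using H.M.finsum_empty M.finsum_empty by simp
  next
    case (insert a A)
    then have "f \<in> A \<rightarrow> carrier M" "f a \<in> carrier M" using sub by auto
    with insert show ?case by simp
  qed
  have eq: "(\<Oplus>\<^bsub>M\<lparr>carrier := H\<rparr>\<^esub>k\<in>{1..n}. F k \<odot>\<^bsub>M\<lparr>carrier := H\<rparr>\<^esub> v k) = (\<Oplus>\<^bsub>M\<^esub>k\<in>{1..n}. F k \<odot>\<^bsub>M\<^esub> v k)"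
    if "F \<in> {1..n} \<rightarrow> carrier (L0 m)" "v \<in> {1..n} \<rightarrow> S" for n :: nat and F v
    using fs[of "{1..n}" "\<lambda>k. F k \<odot>\<^bsub>M\<^esub> v k"] that S submoduleE(4)[OF H] by (auto simp: Pi_iff subset_iff)
  show ?thesis
    unfolding L0_combinations_def
    by (intro Collect_cong ex_cong1 rev_conj_cong) (simp_all only: eq)
qed

text \<open>Taking the closure is what makes the submodule complete. Only the carrier of
  \<open>M\<close> is replaced, so all stages share their operations and norm, and the maps between
  them are inclusions.\<close>

definition generated_submodule ::
    "'x measure \<Rightarrow> 'x measure \<Rightarrow> ('x, 'v) nmodule \<Rightarrow> 'v set \<Rightarrow> ('x, 'v) nmodule" where
  "generated_submodule m m' M S =
     M\<lparr>carrier := Metric_space.mtopology (carrier M) (mod_dist m' M) closure_of L0_combinations m M S\<rparr>"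

lemma generated_submodule_simps [simp]:
  "add (generated_submodule m m' M S) = add M"
  "smult (generated_submodule m m' M S) = smult M"
  "pnorm (generated_submodule m m' M S) = pnorm M"
  by (simp_all add: generated_submodule_def)

lemma L0_combinations_mono: "S \<subseteq> T \<Longrightarrow> L0_combinations m M S \<subseteq> L0_combinations m M T"
  using Pi_mono[of "{1.._}" "\<lambda>_. S" "\<lambda>_. T"] unfolding L0_combinations_def by fast

lemma generated_submodule_mono:
  "S \<subseteq> T \<Longrightarrow> carrier (generated_submodule m m' M S) \<subseteq> carrier (generated_submodule m m' M T)"
  unfolding generated_submodule_def by (simp add: closure_of_mono L0_combinations_mono)

text \<open>The closure is taken in the topology of \<open>M\<close>, whereas
  \<open>generates\<close> asks for density in the topology of the submodule itself. The two
  distances agree on the submodule, so a combination close to a point in one sense is close in the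
  other.\<close>

lemma (in normed_L0_module) generated_submodule:
  assumes sb: "sets m = sets borel" and ref: "reference_measure m m'" and S: "S \<subseteq> carrier M"
  shows "normed_L0_module m m' (generated_submodule m m' M S)"
    and "S \<subseteq> carrier (generated_submodule m m' M S)"
    and "carrier (generated_submodule m m' M S) \<subseteq> carrier M"
    and "generates m m' (generated_submodule m m' M S) S"
proof -
  interpret D: Metric_space "carrier M" "mod_dist m' M"
    by (rule Metric_space_mod_dist[OF sb ref])
  define C where "C = L0_combinations m M S"
  define K where "K = D.mtopology closure_of C"
  note C = submodule_L0_combinations[OF S, folded C_def]
  have G: "generated_submodule m m' M S = M\<lparr>carrier := K\<rparr>"
    by (simp add: generated_submodule_def C_def K_def)
  have K: "submodule K (L0 m) M" unfolding K_def by (rule closure_of_submodule[OF sb ref C])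
  have CK: "C \<subseteq> K" unfolding K_def using submoduleE(1)[OF C] by (intro closure_of_subset) simp
  show nm: "normed_L0_module m m' (generated_submodule m m' M S)"
    unfolding G by (rule normed_L0_closed_submodule[OF sb ref K]) (simp add: K_def)
  have SK: "S \<subseteq> K" using L0_combinations_superset[OF S] CK by (auto simp: C_def)
  then show "S \<subseteq> carrier (generated_submodule m m' M S)" by (simp add: G)
  have KM: "K \<subseteq> carrier M" by (rule submoduleE(1)[OF K])
  then show "carrier (generated_submodule m m' M S) \<subseteq> carrier M" by (simp add: G)
  interpret K: pointwise_normed_module m "M\<lparr>carrier := K\<rparr>"
    by (rule pointwise_normed_submodule[OF K])
  interpret DK: Metric_space K "mod_dist m' (M\<lparr>carrier := K\<rparr>)"
    using K.Metric_space_mod_dist[OF sb ref] by simp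
  have "\<exists>y\<in>C. y \<in> DK.mball x e" if xe: "x \<in> K" "e > 0" for x e
  proof -
    obtain y where "y \<in> C" "y \<in> D.mball x e"
      using xe unfolding K_def D.metric_closure_of by blast
    then show ?thesis
      using CK xe mod_dist_submodule[OF K xe(1), of y] by (intro bexI[of _ y]) auto
  qed
  then have "DK.mtopology closure_of C = K" by (auto simp: DK.metric_closure_of)
  then show "generates m m' (generated_submodule m m' M S) S"
    using SK L0_combinations_submodule[OF K SK] by (simp add: generates_def G C_def)
qed

section \<open>The direct limit\<close>

text \<open>Serves for the transition maps, the maps into the limit and the identity of
  \<open>M\<close>. That \<open>K\<close> is itself a module keeps sums and multiples in its
  carrier, where the restricted identity acts as the identity.\<close>

lemma (in pointwise_normed_module) inclusion_normed_morphism: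
  assumes "carrier K \<subseteq> carrier N" "carrier N \<subseteq> carrier M"
    and K: "pointwise_normed_module m K"
    and "add K = add M" "smult K = smult M" "pnorm K = pnorm M"
    and "add N = add M" "smult N = smult M" "pnorm N = pnorm M"
  shows "(\<lambda>v\<in>carrier K. v) \<in> normed_morphisms m K N"
proof -
  interpret K: pointwise_normed_module m K by fact
  have "L0_le m F F" if "F \<in> carrier (L0 m)" for F
    using that by (auto elim!: L0_cases simp: L0_le_ae_class)
  then show ?thesis
    using assms K.M.add.m_closed K.smult_closed K.pnorm_closed by (auto simp: normed_morphisms_def)
qed

theorem lemma2p5:
  fixes m m' :: "'x::polish_space measure" and M :: "('x, 'v) nmodule"
  assumes "radon_measure m" and "reference_measure m m'"
    and "normed_L0_module m m' M"
  shows "\<exists>(I :: 'v set set) r (D :: 'v set \<Rightarrow> ('x, 'v) nmodule) \<phi> (L :: ('x, 'v) nmodule) \<iota>.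
           direct_system m m' I r D \<phi> \<and>
           (\<forall>i\<in>I. finitely_generated m m' (D i)) \<and>
           is_direct_limit TYPE('w) m m' I r D \<phi> L \<iota> \<and>
           isomorphic m M L"
proof -
  interpret M: normed_L0_module m m' M by fact
  have sb: "sets m = sets borel" using assms(1) by (simp add: radon_measure_def)
  note gen = M.generated_submodule[OF sb assms(2)]
  define I where "I = {S. finite S \<and> S \<subseteq> carrier M}"
  define r where "r = {(S, T). S \<in> I \<and> T \<in> I \<and> S \<subseteq> T}"
  define D where "D = generated_submodule m m' M"
  define \<iota> where "\<iota> S = (\<lambda>v\<in>carrier (D S). v)" for S
  \<comment> \<open>As an extensional function, the inclusion of \<open>D S\<close> into a larger
    stage does not depend on that stage, so it coincides with the map \<open>\<iota> S\<close> into
    \<open>M\<close>.\<close>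
  define \<phi> where "\<phi> S T = \<iota> S" for S and T :: "'v set"
  have ops: "add (D S) = add M" "smult (D S) = smult M" "pnorm (D S) = pnorm M" for S
    by (simp_all add: D_def)
  have nD: "normed_L0_module m m' (D S)" and SD: "S \<subseteq> carrier (D S)"
    and DM: "carrier (D S) \<subseteq> carrier M" and gD: "generates m m' (D S) S" if "S \<in> I" for S
    using gen[of S] that by (simp_all add: D_def I_def)
  have pD: "pointwise_normed_module m (D S)" if "S \<in> I" for S
    using nD[OF that] by (simp add: normed_L0_module_def)
  have mono: "carrier (D S) \<subseteq> carrier (D T)" if "S \<subseteq> T" for S T
    using generated_submodule_mono[OF that] by (simp add: D_def)
  have "directed_poset I r"
    unfolding directed_poset_def
  proof (intro conjI ballI)
    show "I \<noteq> {}" by (auto simp: I_def)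
    show "partial_order_on I r"
      by (auto simp: partial_order_on_def preorder_on_def refl_on_def trans_def antisym_def r_def)
    show "\<exists>k\<in>I. (i, k) \<in> r \<and> (j, k) \<in> r" if "i \<in> I" "j \<in> I" for i j
      using that by (intro bexI[of _ "i \<union> j"]) (auto simp: r_def I_def)
  qed
  moreover have "\<phi> i j \<in> normed_morphisms m (D i) (D j)" if "(i, j) \<in> r" for i j
    unfolding \<phi>_def \<iota>_def using that pD DM
    by (intro M.inclusion_normed_morphism mono) (auto simp: r_def ops)
  moreover have "\<phi> i k = compose (carrier (D i)) (\<phi> j k) (\<phi> i j)"
    if "(i, j) \<in> r" "(j, k) \<in> r" for i j k
    using that mono[of i j] by (auto simp: \<phi>_def \<iota>_def r_def compose_def fun_eq_iff)
  ultimately have sys: "direct_system m m' I r D \<phi>"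
    using nD by (auto simp: direct_system_def \<phi>_def \<iota>_def)
  have fg: "\<forall>S\<in>I. finitely_generated m m' (D S)"
    using gD by (auto simp: finitely_generated_def I_def)
  have "\<iota> S \<in> normed_morphisms m (D S) M" if "S \<in> I" for S
    unfolding \<iota>_def using that pD DM by (intro M.inclusion_normed_morphism) (auto simp: ops)
  moreover have "compose (carrier (D i)) (\<iota> j) (\<phi> i j) = \<iota> i" if "(i, j) \<in> r" for i j
    using that mono[of i j] by (auto simp: \<phi>_def \<iota>_def r_def compose_def fun_eq_iff)
  ultimately have tM: "is_target m m' I r D \<phi> M \<iota>"
    using assms(3) by (auto simp: is_target_def)
  have "\<exists>!\<Phi>. \<Phi> \<in> normed_morphisms m M N \<and> (\<forall>i\<in>I. compose (carrier (D i)) \<Phi> (\<iota> i) = \<psi> i)"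
    if t: "is_target m m' I r D \<phi> N \<psi>" for N :: "('x, 'w) nmodule" and \<psi>
  proof -
    have \<psi>: "\<psi> S \<in> normed_morphisms m (D S) N" if "S \<in> I" for S
      using t that by (simp add: is_target_def)
    \<comment> \<open>Along inclusions, compatibility of a target says that the component of a
      larger stage extends that of a smaller one.\<close>
    have ext: "\<psi> T v = \<psi> S v" if "S \<subseteq> T" "T \<in> I" "v \<in> carrier (D S)" for S T v
    proof -
      have "(S, T) \<in> r" using that finite_subset by (auto simp: r_def I_def)
      then have "compose (carrier (D S)) (\<psi> T) (\<phi> S T) v = \<psi> S v"
        using t by (auto simp: is_target_def)
      then show ?thesis using that by (simp add: compose_def \<phi>_def \<iota>_def)
    qed
    define \<Phi> where "\<Phi> = (\<lambda>v\<in>carrier M. \<psi> {v} v)"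
    \<comment> \<open>The stage \<open>insert v S\<close> lies above both \<open>{v}\<close> and
      \<open>S\<close>, and its component agrees with both at \<open>v\<close>. Hence
      \<open>\<Phi> v\<close> can be computed at any stage containing \<open>v\<close>.\<close>
    have \<Phi>: "\<Phi> v = \<psi> S v" if "S \<in> I" "v \<in> carrier (D S)" for S v
    proof -
      have v: "v \<in> carrier M" using that DM by auto
      then have "{v} \<in> I" and U: "insert v S \<in> I" using that by (auto simp: I_def)
      then have "\<psi> (insert v S) v = \<psi> {v} v" "\<psi> (insert v S) v = \<psi> S v"
        using SD[of "{v}"] that by (auto intro!: ext)
      then show ?thesis using v by (simp add: \<Phi>_def)
    qed
    have "\<Phi> (v \<oplus>\<^bsub>M\<^esub> w) = \<Phi> v \<oplus>\<^bsub>N\<^esub> \<Phi> w" if "v \<in> carrier M" "w \<in> carrier M" for v w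
    proof -
      \<comment> \<open>With the sum among the generators, all three vectors visibly lie in one
        stage, where \<open>\<Phi>\<close> is the additive map \<open>\<psi> S\<close>. The scalar
        case uses the same device.\<close>
      have S: "{v, w, v \<oplus>\<^bsub>M\<^esub> w} \<in> I" using that by (auto simp: I_def)
      show ?thesis using \<psi>[OF S] SD[OF S] by (auto simp: \<Phi>[OF S] normed_morphisms_def ops)
    qed
    moreover have "\<Phi> (F \<odot>\<^bsub>M\<^esub> v) = F \<odot>\<^bsub>N\<^esub> \<Phi> v" if "F \<in> carrier (L0 m)" "v \<in> carrier M" for F v
    proof -
      have S: "{v, F \<odot>\<^bsub>M\<^esub> v} \<in> I" using that by (auto simp: I_def)
      show ?thesis using \<psi>[OF S] SD[OF S] that by (auto simp: \<Phi>[OF S] normed_morphisms_def ops)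
    qed
    moreover have "\<Phi> v \<in> carrier N \<and> L0_le m (pnorm N (\<Phi> v)) (pnorm M v)" if "v \<in> carrier M" for v
    proof -
      have S: "{v} \<in> I" using that by (auto simp: I_def)
      show ?thesis using \<psi>[OF S] SD[OF S] by (auto simp: \<Phi>[OF S] normed_morphisms_def ops)
    qed
    ultimately have \<Phi>m: "\<Phi> \<in> normed_morphisms m M N"
      by (auto simp: normed_morphisms_def \<Phi>_def)
    have \<Phi>\<iota>: "compose (carrier (D S)) \<Phi> (\<iota> S) = \<psi> S" if S: "S \<in> I" for S
      using \<psi>[OF S] \<Phi>[OF S]
      by (auto simp: fun_eq_iff compose_def \<iota>_def normed_morphisms_def PiE_def extensional_def)
    \<comment> \<open>Every \<open>v\<close> of \<open>M\<close> is the image of itself under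
      \<open>\<iota> {v}\<close>, so the condition at the index \<open>{v}\<close> forces the value.
      Off the carrier, both maps are extensional.\<close>
    have "\<Psi> = \<Phi>" if \<Psi>: "\<Psi> \<in> normed_morphisms m M N"
      and c: "\<forall>i\<in>I. compose (carrier (D i)) \<Psi> (\<iota> i) = \<psi> i" for \<Psi>
    proof
      fix v
      show "\<Psi> v = \<Phi> v"
      proof (cases "v \<in> carrier M")
        case True
        then have S: "{v} \<in> I" by (auto simp: I_def)
        then have "compose (carrier (D {v})) \<Psi> (\<iota> {v}) v = \<psi> {v} v" using c by simp
        then show ?thesis using SD[OF S] True by (simp add: compose_def \<iota>_def \<Phi>_def)
      next
        case False
        then show ?thesis using \<Psi>
          by (auto simp: \<Phi>_def normed_morphisms_def PiE_def extensional_def)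
      qed
    qed
    with \<Phi>m \<Phi>\<iota> show ?thesis by blast
  qed
  \<comment> \<open>The limit object is \<open>M\<close> itself, so the required isomorphism is the
    identity.\<close>
  with tM have lim: "is_direct_limit TYPE('w) m m' I r D \<phi> M \<iota>"
    by (simp add: is_direct_limit_def)
  have "(\<lambda>v\<in>carrier M. v) \<in> normed_morphisms m M M"
    by (rule M.inclusion_normed_morphism) (auto intro: M.pointwise_normed_module_axioms)
  then have "isomorphic m M M"
    by (auto simp: isomorphic_def compose_def fun_eq_iff intro!: bexI[of _ "\<lambda>v\<in>carrier M. v"])
  with sys fg lim show ?thesis by blast
qed

end
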